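(* Let $\mathbf{a},\mathbf{b}\in{\rm SL}(3,\mathbb{C})$ be symmetric matrices such that the pair $(\mathbf{a},\mathbf{b})$ is irreducible. (i) If $\mathbf{a}$ is special (so that $\mathbf{b}$ is ordinary), then $\{\mathbf{e},\mathbf{a},\mathbf{b},\mathbf{b}^{-1},\theta(\mathbf{a}\mathbf{b}),\theta(\mathbf{a}\mathbf{b}^{-1})\}$ is a basis of $\mathcal{M}^0$, and $\{\delta(\mathbf{a}\mathbf{b}),\delta(\mathbf{a}\mathbf{b}^{-1}),\delta(\mathbf{b}\mathbf{a}\mathbf{b}^{-1})\}$ is a basis of $\mathcal{M}^1$. (ii) If $\mathbf{a},\mathbf{b}$ are both ordinary, then at least one of the following occurs: 1) $\{\mathbf{e},\mathbf{a},\mathbf{a}^{-1},\mathbf{b},\mathbf{b}^{-1},\theta(\mathbf{a}\mathbf{b})\}$ is a basis of $\mathcal{M}^0$, and $\{\delta(\mathbf{a}\mathbf{b}),\delta(\mathbf{a}^{-1}\mathbf{b}),\delta(\mathbf{a}\mathbf{b}^{-1})\}$ is a basis of $\mathcal{M}^1$, so $\{\mathbf{e},\mathbf{a},\mathbf{a}^{-1},\mathbf{b},\mathbf{b}^{-1},\mathbf{a}\mathbf{b},\mathbf{b}\mathbf{a},\mathbf{a}^{-1}\mathbf{b},\mathbf{a}\mathbf{b}^{-1}\}$ is a basis of $\mathcal{M}$; 2) $\{\mathbf{e},\mathbf{a},\mathbf{a}^{-1},\mathbf{b},\mathbf{b}^{-1},\theta(\mathbf{a}^{-1}\mathbf{b})\}$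 is a basis of $\mathcal{M}^0$, and $\{\delta(\mathbf{a}\mathbf{b}),\delta(\mathbf{a}^{-1}\mathbf{b}),\delta(\mathbf{a}^{-1}\mathbf{b}^{-1})\}$ is a basis of $\mathcal{M}^1$, so $\{\mathbf{e},\mathbf{a},\mathbf{a}^{-1},\mathbf{b},\mathbf{b}^{-1},\mathbf{a}\mathbf{b},\mathbf{b}\mathbf{a}^{-1},\mathbf{a}^{-1}\mathbf{b},\mathbf{a}^{-1}\mathbf{b}^{-1}\}$ is a basis of $\mathcal{M}$. Therefore, in either of these two cases (with $\mathbf{a},\mathbf{b}$ both ordinary), \begin{align*} \mathcal{M}^0&=\mathbb{C}\langle\mathbf{e},\mathbf{a},\mathbf{a}^{-1},\mathbf{b},\mathbf{b}^{-1},\theta(\mathbf{a}\mathbf{b}),\theta(\mathbf{a}^{-1}\mathbf{b})\rangle,\\ \mathcal{M}^1&=\mathbb{C}\langle\delta(\mathbf{a}\mathbf{b}),\delta(\mathbf{a}^{-1}\mathbf{b}),\delta(\mathbf{a}\mathbf{b}^{-1}),\delta(\mathbf{a}^{-1}\mathbf{b}^{-1})\rangle,\\ \mathcal{M}&=\mathbb{C}\langle\mathbf{e},\mathbf{a},\mathbf{a}^{-1},\mathbf{b},\mathbf{b}^{-1},\mathbf{a}\mathbf{b},\mathbf{b}\mathbf{a},\mathbf{a}^{-1}\mathbf{b},\mathbf{b}\mathbf{a}^{-1},\mathbf{a}\mathbf{b}^{-1},\mathbf{a}^{-1}\mathbf{b}^{-1}\rangle. \end{align*}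
   Context: $\mathcal{M}$ is the complex vector space of $3\times3$ complex matrices; $\mathcal{M}^0$ and $\mathcal{M}^1$ are its subspaces of symmetric and skew-symmetric matrices, respectively; $\mathbf{e}$ is the identity matrix; $\mathbb{C}\langle\ldots\rangle$ denotes the complex linear span. For a word $\mathbf{w}$ in $\mathbf{a}^{\pm1},\mathbf{b}^{\pm1}$, $\overleftarrow{\mathbf{w}}$ denotes the word written backwards (letters in reverse order, not inverted), and $\theta(\mathbf{w})=\mathbf{w}+\overleftarrow{\mathbf{w}}$, $\delta(\mathbf{w})=\mathbf{w}-\overleftarrow{\mathbf{w}}$. An element $\mathbf{x}\in{\rm SL}(3,\mathbb{C})$ is ordinary if its minimal polynomial has degree $3$ (equivalently, each eigenspace of $\mathbf{x}$ is one-dimensional), and special otherwise. A pair $(\mathbf{a},\mathbf{b})$ of elements of ${\rm SL}(3,\mathbb{C})$ is irreducible if the representation of the free group of rank two on $\mathbb{C}^3$ sending its two free generators to $\mathbf{a},\mathbf{b}$ is irreducible; equivalently, $\mathbf{a},\mathbf{b}$ have no common eigenvector and $\mathbf{a}^{\rm tr},\mathbf{b}^{\rm tr}$ have no common eigenvector. *)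

theory Defs
  imports "HOL-Analysis.Analysis" "HOL-Computational_Algebra.Polynomial"
begin

type_synonym mat3 = "complex^3^3"

text \<open>The library's \<open>*s\<close> on \<open>'a^'n\<close> takes scalars from the entry type, so it does not give
  the complex scalar multiplication of matrices.\<close>

definition smult_mat :: "complex \<Rightarrow> mat3 \<Rightarrow> mat3"  (infixr "*\<^sub>m" 75) where
  "c *\<^sub>m A = (\<chi> i j. c * A $ i $ j)"

interpretation cmat: vector_space smult_mat
  by unfold_locales (simp_all add: smult_mat_def vec_eq_iff algebra_simps)

definition sym_mats :: "mat3 set" where
  "sym_mats = {A. transpose A = A}"

definition skew_mats :: "mat3 set" where
  "skew_mats = {A. transpose A = - A}"

text \<open>A basis is a family, so a repeated entry is excluded.\<close>

definition is_basis :: "mat3 list \<Rightarrow> mat3 set \<Rightarrow> bool" where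
  "is_basis xs V \<longleftrightarrow> distinct xs \<and> cmat.independent (set xs) \<and> cmat.span (set xs) = V"

definition SL3 :: "mat3 set" where
  "SL3 = {A. det A = 1}"

text \<open>The power \<open>^\<close> on \<open>'a^'n^'n\<close> is entrywise; the power of a square matrix is an iterated \<open>**\<close>.\<close>

definition mat_poly :: "complex poly \<Rightarrow> mat3 \<Rightarrow> mat3" where
  "mat_poly p A = (\<Sum>i\<le>degree p. coeff p i *\<^sub>m (((**) A ^^ i) (mat 1)))"

definition is_min_poly :: "complex poly \<Rightarrow> mat3 \<Rightarrow> bool" where
  "is_min_poly p A \<longleftrightarrow> lead_coeff p = 1 \<and> mat_poly p A = 0 \<and>
     (\<forall>q. lead_coeff q = 1 \<and> mat_poly q A = 0 \<longrightarrow> degree p \<le> degree q)"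

definition ordinary :: "mat3 \<Rightarrow> bool" where
  "ordinary A \<longleftrightarrow> A \<in> SL3 \<and> (\<exists>p. is_min_poly p A \<and> degree p = 3)"

definition special :: "mat3 \<Rightarrow> bool" where
  "special A \<longleftrightarrow> A \<in> SL3 \<and> \<not> ordinary A"

text \<open>Words in two generators and their inverses. A word is a formal object, since its reversal is
  not determined by the matrix that it represents.\<close>

datatype letter = La | La_inv | Lb | Lb_inv

fun eval_letter :: "mat3 \<Rightarrow> mat3 \<Rightarrow> letter \<Rightarrow> mat3" where
  "eval_letter a b La = a"
| "eval_letter a b La_inv = matrix_inv a"
| "eval_letter a b Lb = b"
| "eval_letter a b Lb_inv = matrix_inv b"

definition eval_word :: "mat3 \<Rightarrow> mat3 \<Rightarrow> letter list \<Rightarrow> mat3" where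
  "eval_word a b w = foldr (\<lambda>l M. eval_letter a b l ** M) w (mat 1)"

definition theta :: "mat3 \<Rightarrow> mat3 \<Rightarrow> letter list \<Rightarrow> mat3" where
  "theta a b w = eval_word a b w + eval_word a b (rev w)"

definition delta :: "mat3 \<Rightarrow> mat3 \<Rightarrow> letter list \<Rightarrow> mat3" where
  "delta a b w = eval_word a b w - eval_word a b (rev w)"

text \<open>For invertible \<open>a\<close> and \<open>b\<close>, the matrices \<open>eval_word a b w\<close> form the image of the representation
  of the free group of rank two that sends its generators to \<open>a\<close> and \<open>b\<close>.\<close>

definition irreducible_pair :: "mat3 \<Rightarrow> mat3 \<Rightarrow> bool" where
  "irreducible_pair a b \<longleftrightarrow>
     (\<forall>V :: (complex^3) set. vec.subspace V \<and> (\<forall>w. \<forall>v\<in>V. eval_word a b w *v v \<in> V)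
        \<longrightarrow> V = {0} \<or> V = UNIV)"

end

theory Submission
  imports Defs "HOL-Computational_Algebra.Fundamental_Theorem_Algebra"
begin

text \<open>If \<open>a\<close> is special, then \<open>a = k e + u u\<^sup>T\<close> for some scalar \<open>k\<close> and vector \<open>u\<close>, and irreducibility
  makes \<open>u, b u, b\<^bsup>-1\<^esup> u\<close> a basis of the space of vectors. The three commutators are its wedge
  products. A linear relation between the six symmetric matrices writes a combination of the symmetric
  products \<open>u x\<^sup>T + x u\<^sup>T\<close> as a polynomial in \<open>b\<close>; since it commutes with \<open>b\<close>, it vanishes.

  If \<open>a\<close> and \<open>b\<close> are ordinary, a dimension count gives skew-symmetric \<open>s\<close> and \<open>t\<close>, not both zero, with
  \<open>[a, s] = [b, t] =: q\<close>. Under the trace form \<open>q\<close> spans the orthogonal complement of the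
  five-dimensional space \<open>\<complex>[a] + \<complex>[b]\<close>. If \<open>tr (q a b) \<noteq> 0\<close>, the functionals defined by \<open>q\<close>, \<open>s\<close> and \<open>t\<close>
  separate the matrices of the first case. The second case is the first one for \<open>a\<^bsup>-1\<^esup>\<close> and \<open>b\<close>, with
  the same \<open>q\<close>. If both \<open>tr (q a b)\<close> and \<open>tr (q a\<^bsup>-1\<^esup> b)\<close> vanished, then \<open>[a, t]\<close> and \<open>[a\<^bsup>-1\<^esup>, t]\<close> would
  be multiples of \<open>q = [b, t]\<close>, so \<open>t\<close> would commute with two matrices \<open>a - k b\<close> and \<open>a\<^bsup>-1\<^esup> - l b\<close>; but
  the symmetric matrices commuting with \<open>t\<close> are spanned by \<open>e\<close> and \<open>t\<^sup>2\<close>.\<close>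

section \<open>Bases of spaces of matrices\<close>

text \<open>Independence of the indexed family: a repeated entry counts as a dependence. This single
  condition yields both distinctness and independence of the underlying set.\<close>

definition indep_list :: "mat3 list \<Rightarrow> bool" where
  "indep_list xs \<longleftrightarrow>
     (\<forall>c. (\<Sum>i<length xs. c i *\<^sub>m xs ! i) = 0 \<longrightarrow> (\<forall>i<length xs. c i = 0))"

lemma indep_list_distinct:
  assumes "indep_list xs"
  shows "distinct xs"
proof (rule ccontr)
  assume "\<not> distinct xs"
  then obtain i j where ij: "i < length xs" "j < length xs" "i \<noteq> j" "xs ! i = xs ! j"
    by (auto simp: distinct_conv_nth)
  define c :: "nat \<Rightarrow> complex" where "c k = (if k = i then 1 else if k = j then -1 else 0)" for k
  have "(\<Sum>k<length xs. c k *\<^sub>m xs ! k) = (\<Sum>k\<in>{i, j}. c k *\<^sub>m xs ! k)"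
    by (rule sum.mono_neutral_right) (use ij in \<open>auto simp: c_def\<close>)
  also have "\<dots> = 0"
    using ij by (simp add: c_def)
  finally have "c i = 0"
    using assms ij(1) by (simp add: indep_list_def)
  then show False
    by (simp add: c_def)
qed

lemma indep_list_independent:
  assumes "indep_list xs"
  shows "cmat.independent (set xs)"
proof (rule cmat.independent_if_scalars_zero)
  fix f x
  assume 0: "(\<Sum>x\<in>set xs. f x *\<^sub>m x) = 0" and x: "x \<in> set xs"
  have "bij_betw ((!) xs) {..<length xs} (set xs)"
    using indep_list_distinct[OF assms] by (simp add: bij_betw_nth)
  from sum.reindex_bij_betw[OF this, of "\<lambda>x. f x *\<^sub>m x"] 0
  have "(\<Sum>i<length xs. f (xs ! i) *\<^sub>m xs ! i) = 0"
    by simp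
  then have "\<forall>i<length xs. f (xs ! i) = 0"
    using assms unfolding indep_list_def by (elim allE[of _ "\<lambda>i. f (xs ! i)"]) simp
  with x show "f x = 0"
    by (auto simp: in_set_conv_nth)
qed simp

lemma indep_list_length_le:
  assumes "indep_list xs" and "set xs \<subseteq> cmat.span (set ts)"
  shows "length xs \<le> length ts"
proof -
  have "card (set xs) \<le> card (set ts)"
    using cmat.independent_span_bound[OF _ indep_list_independent[OF assms(1)] assms(2)] by simp
  then show ?thesis
    using distinct_card[OF indep_list_distinct[OF assms(1)]] card_length[of ts] by linarith
qed

text \<open>An element of \<open>V\<close> outside the span would enlarge \<open>xs\<close> to an
  independent set with more elements than the generating list \<open>ts\<close>.\<close>

lemma is_basisI:
  assumes "indep_list xs" and "set xs \<subseteq> V" and "cmat.subspace V"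
    and "V \<subseteq> cmat.span (set ts)" and "length ts \<le> length xs"
  shows "is_basis xs V"
proof -
  have ind: "cmat.independent (set xs)" and dis: "distinct xs"
    using assms(1) by (simp_all add: indep_list_independent indep_list_distinct)
  have "x \<in> cmat.span (set xs)" if x: "x \<in> V" for x
  proof (rule ccontr)
    assume nx: "x \<notin> cmat.span (set xs)"
    then have "cmat.independent (insert x (set xs))"
      using ind by (simp add: cmat.independent_insert)
    moreover have "insert x (set xs) \<subseteq> cmat.span (set ts)"
      using assms(2,4) x by auto
    ultimately have "card (insert x (set xs)) \<le> card (set ts)"
      using cmat.independent_span_bound[of "set ts"] by simp
    moreover have "x \<notin> set xs"
      using nx cmat.span_base by blast
    ultimately show False
      using distinct_card[OF dis] card_length[of ts] assms(5) by simp
  qed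
  then have "cmat.span (set xs) = V"
    using cmat.span_minimal[OF assms(2,3)] by blast
  with ind dis show ?thesis
    by (simp add: is_basis_def)
qed

lemma is_basis_perm:
  assumes "is_basis xs V" and "mset xs = mset ys"
  shows "is_basis ys V"
  using assms mset_eq_imp_distinct_iff[OF assms(2)] mset_eq_setD[OF assms(2)]
  by (simp add: is_basis_def)

section \<open>Coordinates and standard generators of the symmetric and skew-symmetric
  matrices\<close>

lemma mat3_eq_iff:
  fixes A B :: "'a^3^3"
  shows "A = B \<longleftrightarrow>
    A$1$1 = B$1$1 \<and> A$1$2 = B$1$2 \<and> A$1$3 = B$1$3 \<and>
    A$2$1 = B$2$1 \<and> A$2$2 = B$2$2 \<and> A$2$3 = B$2$3 \<and>
    A$3$1 = B$3$1 \<and> A$3$2 = B$3$2 \<and> A$3$3 = B$3$3"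
  by (simp add: vec_eq_iff forall_3)

definition mat3 :: "complex \<Rightarrow> complex \<Rightarrow> complex \<Rightarrow> complex \<Rightarrow> complex \<Rightarrow> complex \<Rightarrow>
    complex \<Rightarrow> complex \<Rightarrow> complex \<Rightarrow> mat3" where
  "mat3 a b c d e f g h i = vector [vector [a, b, c], vector [d, e, f], vector [g, h, i]]"

lemma mat3_nth [simp]:
  "mat3 a b c d e f g h i $ 1 $ 1 = a" "mat3 a b c d e f g h i $ 1 $ 2 = b"
  "mat3 a b c d e f g h i $ 1 $ 3 = c" "mat3 a b c d e f g h i $ 2 $ 1 = d"
  "mat3 a b c d e f g h i $ 2 $ 2 = e" "mat3 a b c d e f g h i $ 2 $ 3 = f"
  "mat3 a b c d e f g h i $ 3 $ 1 = g" "mat3 a b c d e f g h i $ 3 $ 2 = h"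
  "mat3 a b c d e f g h i $ 3 $ 3 = i"
  by (simp_all add: mat3_def)

lemma smult_mat_nth [simp]: "(c *\<^sub>m A) $ i $ j = c * A $ i $ j"
  by (simp add: smult_mat_def)

lemma mat_mult_nth: "(A ** B) $ i $ j = A$i$1 * B$1$j + A$i$2 * B$2$j + A$i$3 * B$3$j"
  for A B :: mat3
  by (simp add: matrix_matrix_mult_def sum_3)

lemma trace_mat3: "trace A = A$1$1 + A$2$2 + A$3$3" for A :: mat3
  by (simp add: trace_def sum_3)

lemma mat_nth: "(mat c :: mat3) $ i $ j = (if i = j then c else 0)"
  by (simp add: mat_def)

lemma sym_mats_iff: "A \<in> sym_mats \<longleftrightarrow> A$2$1 = A$1$2 \<and> A$3$1 = A$1$3 \<and> A$3$2 = A$2$3"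
  by (auto simp: sym_mats_def mat3_eq_iff transpose_def)

lemma skew_mats_iff:
  "A \<in> skew_mats \<longleftrightarrow> A$1$1 = 0 \<and> A$2$2 = 0 \<and> A$3$3 = 0 \<and>
     A$2$1 = - A$1$2 \<and> A$3$1 = - A$1$3 \<and> A$3$2 = - A$2$3"
  by (auto simp: skew_mats_def mat3_eq_iff transpose_def)

lemma subspace_sym_mats: "cmat.subspace sym_mats"
  by (simp add: cmat.subspace_def sym_mats_iff)

lemma subspace_skew_mats: "cmat.subspace skew_mats"
  by (simp add: cmat.subspace_def skew_mats_iff)

definition sym_gens :: "mat3 list" where
  "sym_gens = [mat3 1 0 0 0 0 0 0 0 0, mat3 0 0 0 0 1 0 0 0 0, mat3 0 0 0 0 0 0 0 0 1,
     mat3 0 1 0 1 0 0 0 0 0, mat3 0 0 1 0 0 0 1 0 0, mat3 0 0 0 0 0 1 0 1 0]"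

definition traceless_sym_gens :: "mat3 list" where
  "traceless_sym_gens = [mat3 1 0 0 0 0 0 0 0 (-1), mat3 0 0 0 0 1 0 0 0 (-1),
     mat3 0 1 0 1 0 0 0 0 0, mat3 0 0 1 0 0 0 1 0 0, mat3 0 0 0 0 0 1 0 1 0]"

definition skew_gens :: "mat3 list" where
  "skew_gens = [mat3 0 1 0 (-1) 0 0 0 0 0, mat3 0 0 1 0 0 0 (-1) 0 0, mat3 0 0 0 0 0 1 0 (-1) 0]"

lemma sym_mats_subset_span: "sym_mats \<subseteq> cmat.span (set sym_gens)"
proof
  fix A assume "A \<in> sym_mats"
  then have "A = A$1$1 *\<^sub>m mat3 1 0 0 0 0 0 0 0 0 + A$2$2 *\<^sub>m mat3 0 0 0 0 1 0 0 0 0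
      + A$3$3 *\<^sub>m mat3 0 0 0 0 0 0 0 0 1 + A$1$2 *\<^sub>m mat3 0 1 0 1 0 0 0 0 0
      + A$1$3 *\<^sub>m mat3 0 0 1 0 0 0 1 0 0 + A$2$3 *\<^sub>m mat3 0 0 0 0 0 1 0 1 0"
    by (simp add: mat3_eq_iff sym_mats_iff)
  also have "\<dots> \<in> cmat.span (set sym_gens)"
    by (intro cmat.span_add cmat.span_scale cmat.span_base) (simp_all add: sym_gens_def)
  finally show "A \<in> cmat.span (set sym_gens)" .
qed

lemma traceless_sym_mats_subset_span:
  "{A \<in> sym_mats. trace A = 0} \<subseteq> cmat.span (set traceless_sym_gens)"
proof
  fix A assume "A \<in> {A \<in> sym_mats. trace A = 0}"
  then have "A \<in> sym_mats" "A$3$3 = - A$1$1 - A$2$2"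
    by (auto simp: trace_mat3 add_eq_0_iff algebra_simps)
  then have "A = A$1$1 *\<^sub>m mat3 1 0 0 0 0 0 0 0 (-1) + A$2$2 *\<^sub>m mat3 0 0 0 0 1 0 0 0 (-1)
      + A$1$2 *\<^sub>m mat3 0 1 0 1 0 0 0 0 0
      + A$1$3 *\<^sub>m mat3 0 0 1 0 0 0 1 0 0 + A$2$3 *\<^sub>m mat3 0 0 0 0 0 1 0 1 0"
    by (simp add: mat3_eq_iff sym_mats_iff)
  also have "\<dots> \<in> cmat.span (set traceless_sym_gens)"
    by (intro cmat.span_add cmat.span_scale cmat.span_base) (simp_all add: traceless_sym_gens_def)
  finally show "A \<in> cmat.span (set traceless_sym_gens)" .
qed

lemma skew_mats_subset_span: "skew_mats \<subseteq> cmat.span (set skew_gens)"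
proof
  fix A assume "A \<in> skew_mats"
  then have "A = A$1$2 *\<^sub>m mat3 0 1 0 (-1) 0 0 0 0 0 + A$1$3 *\<^sub>m mat3 0 0 1 0 0 0 (-1) 0 0
      + A$2$3 *\<^sub>m mat3 0 0 0 0 0 1 0 (-1) 0"
    by (simp add: mat3_eq_iff skew_mats_iff)
  also have "\<dots> \<in> cmat.span (set skew_gens)"
    by (intro cmat.span_add cmat.span_scale cmat.span_base) (simp_all add: skew_gens_def)
  finally show "A \<in> cmat.span (set skew_gens)" .
qed

lemma UNIV_subset_span: "UNIV \<subseteq> cmat.span (set (sym_gens @ skew_gens))"
proof
  fix A :: mat3
  have "A = (1/2) *\<^sub>m (A + transpose A) + (1/2) *\<^sub>m (A - transpose A)"
    by (simp add: mat3_eq_iff field_simps)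
  moreover have "A + transpose A \<in> cmat.span (set (sym_gens @ skew_gens))"
    by (rule subsetD[OF order_trans[OF sym_mats_subset_span cmat.span_mono]])
      (simp_all add: sym_mats_iff transpose_def)
  moreover have "A - transpose A \<in> cmat.span (set (sym_gens @ skew_gens))"
    by (rule subsetD[OF order_trans[OF skew_mats_subset_span cmat.span_mono]])
      (simp_all add: skew_mats_iff transpose_def)
  ultimately show "A \<in> cmat.span (set (sym_gens @ skew_gens))"
    by (metis cmat.span_add cmat.span_scale)
qed

lemma is_basis_symI:
  assumes "indep_list xs" and "set xs \<subseteq> sym_mats" and "length xs = 6"
  shows "is_basis xs sym_mats"
  by (rule is_basisI[OF assms(1,2) subspace_sym_mats sym_mats_subset_span])
    (simp add: assms(3) sym_gens_def)

lemma is_basis_skewI: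
  assumes "indep_list xs" and "set xs \<subseteq> skew_mats" and "length xs = 3"
  shows "is_basis xs skew_mats"
  by (rule is_basisI[OF assms(1,2) subspace_skew_mats skew_mats_subset_span])
    (simp add: assms(3) skew_gens_def)

lemma is_basis_UNIVI:
  assumes "indep_list xs" and "length xs = 9"
  shows "is_basis xs UNIV"
  by (rule is_basisI[OF assms(1) subset_UNIV cmat.subspace_UNIV UNIV_subset_span])
    (simp add: assms(2) sym_gens_def skew_gens_def)

lemma indep_list_3:
  "indep_list [x, y, z] \<longleftrightarrow>
     (\<forall>c d e. c *\<^sub>m x + d *\<^sub>m y + e *\<^sub>m z = 0 \<longrightarrow> c = 0 \<and> d = 0 \<and> e = 0)"
proof
  assume L: "indep_list [x, y, z]"
  show "\<forall>c d e. c *\<^sub>m x + d *\<^sub>m y + e *\<^sub>m z = 0 \<longrightarrow> c = 0 \<and> d = 0 \<and> e = 0"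
  proof (intro allI impI)
    fix c d e assume "c *\<^sub>m x + d *\<^sub>m y + e *\<^sub>m z = 0"
    with L[unfolded indep_list_def, THEN spec, of "(!) [c, d, e]"]
    show "c = 0 \<and> d = 0 \<and> e = 0"
      by (simp add: All_less_Suc add.assoc)
  qed
qed (simp add: indep_list_def All_less_Suc)

section \<open>Matrix algebra\<close>

lemma mat_distribs:
  fixes A B C :: mat3
  shows "(A + B) ** C = A ** C + B ** C" "A ** (B + C) = A ** B + A ** C"
    "(A - B) ** C = A ** C - B ** C" "A ** (B - C) = A ** B - A ** C"
    "(k *\<^sub>m A) ** B = k *\<^sub>m (A ** B)" "A ** (k *\<^sub>m B) = k *\<^sub>m (A ** B)"
    "(- A) ** B = - (A ** B)" "A ** (- B) = - (A ** B)"
    "0 ** A = 0" "A ** 0 = 0"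
  by (simp_all add: mat3_eq_iff mat_mult_nth algebra_simps)

lemma trace_smult: "trace (k *\<^sub>m A) = k * trace A"
  and trace_zero: "trace (0 :: mat3) = 0"
  for A :: mat3
  by (simp_all add: trace_mat3 algebra_simps)

lemma transpose_distribs:
  fixes A B :: mat3
  shows "transpose (A + B) = transpose A + transpose B"
    "transpose (A - B) = transpose A - transpose B"
    "transpose (- A) = - transpose A"
    "transpose (k *\<^sub>m A) = k *\<^sub>m transpose A"
  by (simp_all add: mat3_eq_iff transpose_def)

text \<open>The sum of the principal 2-by-2 minors, that is, the second elementary symmetric
  function of the eigenvalues.\<close>

definition sigma2 :: "mat3 \<Rightarrow> complex" where
  "sigma2 A = A$1$1 * A$2$2 - A$1$2 * A$2$1 + A$1$1 * A$3$3 - A$1$3 * A$3$1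
     + A$2$2 * A$3$3 - A$2$3 * A$3$2"

lemma cayley_hamilton:
  "A ** (A ** A) = trace A *\<^sub>m (A ** A) - sigma2 A *\<^sub>m A + det A *\<^sub>m mat 1"
  by (simp add: mat3_eq_iff mat_mult_nth trace_mat3 sigma2_def det_3 mat_nth algebra_simps)

lemma matrix_inv_inverse:
  fixes A :: "'a::field^'n^'n"
  assumes "det A \<noteq> 0"
  shows "A ** matrix_inv A = mat 1" "matrix_inv A ** A = mat 1"
proof -
  have "\<exists>B. A ** B = mat 1 \<and> B ** A = mat 1"
    using assms by (simp add: invertible_det_nz flip: invertible_def)
  from someI_ex[OF this] show "A ** matrix_inv A = mat 1" "matrix_inv A ** A = mat 1"
    by (simp_all add: matrix_inv_def)
qed

lemma SL3_inverse:
  assumes "A \<in> SL3"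
  shows "A ** matrix_inv A = mat 1" "matrix_inv A ** A = mat 1"
    "matrix_inv A \<in> SL3" "matrix_inv (matrix_inv A) = A"
proof -
  show 1: "A ** matrix_inv A = mat 1" and 2: "matrix_inv A ** A = mat 1"
    using assms by (simp_all add: SL3_def matrix_inv_inverse)
  have "det A * det (matrix_inv A) = 1"
    using det_mul[of A "matrix_inv A"] 1 by simp
  with assms show 3: "matrix_inv A \<in> SL3"
    by (simp add: SL3_def)
  then have "matrix_inv A ** matrix_inv (matrix_inv A) = mat 1"
    by (simp add: SL3_def matrix_inv_inverse)
  then have "A ** (matrix_inv A ** matrix_inv (matrix_inv A)) = A"
    by simp
  with 1 show "matrix_inv (matrix_inv A) = A"
    by (simp add: matrix_mul_assoc)
qed

text \<open>Cayley-Hamilton divided by \<open>A\<close>. It lets \<open>matrix_inv A\<close> take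
  the place of the square in a spanning set of the polynomials in \<open>A\<close>.\<close>

lemma SL3_square:
  assumes "A \<in> SL3"
  shows "A ** A = trace A *\<^sub>m A - sigma2 A *\<^sub>m mat 1 + matrix_inv A"
proof -
  have "A ** A = matrix_inv A ** (A ** (A ** A))"
    using SL3_inverse[OF assms] by (simp add: matrix_mul_assoc)
  also have "\<dots> = trace A *\<^sub>m (matrix_inv A ** A ** A) - sigma2 A *\<^sub>m (matrix_inv A ** A)
      + matrix_inv A"
    using assms by (subst cayley_hamilton) (simp add: SL3_def mat_distribs matrix_mul_assoc)
  finally show ?thesis
    using SL3_inverse[OF assms] by simp
qed

text \<open>The inverse is a polynomial in \<open>A\<close>, so symmetry, commutation and invariance
  of subspaces pass from \<open>A\<close> to its inverse.\<close>

lemma matrix_inv_eq: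
  assumes "A \<in> SL3"
  shows "matrix_inv A = A ** A - trace A *\<^sub>m A + sigma2 A *\<^sub>m mat 1"
  by (subst SL3_square[OF assms]) simp

lemma matrix_inv_sym:
  assumes "A \<in> SL3" and "A \<in> sym_mats"
  shows "matrix_inv A \<in> sym_mats"
  using assms(2)
  by (simp add: matrix_inv_eq[OF assms(1)] sym_mats_def transpose_distribs matrix_transpose_mul)

lemma commute_matrix_inv:
  assumes "A \<in> SL3" and "C ** A = A ** C"
  shows "C ** matrix_inv A = matrix_inv A ** C"
  by (simp add: matrix_inv_eq[OF assms(1)] mat_distribs matrix_mul_assoc assms(2))
    (simp add: matrix_mul_assoc[symmetric] assms(2))

section \<open>Ordinary matrices\<close>

lemma mat_poly_eq_sum:
  assumes "degree p \<le> n"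
  shows "mat_poly p A = (\<Sum>i\<le>n. coeff p i *\<^sub>m (((**) A ^^ i) (mat 1)))"
  unfolding mat_poly_def
  by (rule sum.mono_neutral_left) (use assms in \<open>auto simp: coeff_eq_0\<close>)

lemma mat_poly_2:
  assumes "degree p \<le> 2"
  shows "mat_poly p A = coeff p 0 *\<^sub>m mat 1 + coeff p 1 *\<^sub>m A + coeff p 2 *\<^sub>m (A ** A)"
  by (simp add: mat_poly_eq_sum[OF assms] numeral_2_eq_2)

lemma mat_poly_3:
  assumes "degree p \<le> 3"
  shows "mat_poly p A = coeff p 0 *\<^sub>m mat 1 + coeff p 1 *\<^sub>m A + coeff p 2 *\<^sub>m (A ** A)
    + coeff p 3 *\<^sub>m (A ** (A ** A))"
  by (simp add: mat_poly_eq_sum[OF assms] numeral_3_eq_3 numeral_2_eq_2)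

definition char_poly3 :: "mat3 \<Rightarrow> complex poly" where
  "char_poly3 A = [:- det A, sigma2 A, - trace A, 1:]"

lemma mat_poly_char_poly3: "mat_poly (char_poly3 A) A = 0"
  by (subst mat_poly_3)
    (simp_all add: char_poly3_def cayley_hamilton numeral_2_eq_2 numeral_3_eq_3)

text \<open>\<open>mat 1\<close>, \<open>A\<close>, \<open>matrix_inv A\<close> span the same space
  as \<open>mat 1\<close>, \<open>A\<close>, \<open>A ** A\<close>. Their independence means that no
  nonzero polynomial of degree at most two annihilates \<open>A\<close>, so that the characteristic
  polynomial is minimal.\<close>

lemma ordinary_iff:
  assumes A: "A \<in> SL3"
  shows "ordinary A \<longleftrightarrow> indep_list [mat 1, A, matrix_inv A]"
proof
  assume "ordinary A"
  then obtain p where p: "is_min_poly p A" "degree p = 3"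
    by (auto simp: ordinary_def)
  have "c = 0 \<and> d = 0 \<and> e = 0"
    if 0: "c *\<^sub>m mat 1 + d *\<^sub>m A + e *\<^sub>m matrix_inv A = 0" for c d e
  proof (rule ccontr)
    assume nz: "\<not> (c = 0 \<and> d = 0 \<and> e = 0)"
    \<comment> \<open>Multiplying the relation by \<open>A\<close> turns it into a polynomial
      relation with these coefficients; \<open>r\<close> is its monic multiple.\<close>
    define q where "q = [:e, c, d:]"
    have q0: "q \<noteq> 0" and degq: "degree q \<le> 2"
      using nz by (auto simp: q_def)
    define r where "r = smult (1 / lead_coeff q) q"
    have "A ** (c *\<^sub>m mat 1 + d *\<^sub>m A + e *\<^sub>m matrix_inv A) = 0"
      unfolding 0 by (simp add: mat_distribs)
    then have "e *\<^sub>m mat 1 + c *\<^sub>m A + d *\<^sub>m (A ** A) = 0"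
      by (simp add: mat_distribs SL3_inverse[OF A] algebra_simps)
    moreover have "mat_poly r A
        = (1 / lead_coeff q) *\<^sub>m (e *\<^sub>m mat 1 + c *\<^sub>m A + d *\<^sub>m (A ** A))"
      using degq
      by (subst mat_poly_2)
        (auto simp: r_def q_def cmat.scale_right_distrib numeral_2_eq_2 intro: order_trans[OF degree_smult_le])
    ultimately have "mat_poly r A = 0"
      by simp
    moreover have "lead_coeff r = 1"
      using q0 by (simp add: r_def)
    ultimately have "degree p \<le> degree r"
      using p(1) by (simp add: is_min_poly_def)
    also have "\<dots> \<le> 2"
      using degq by (simp add: r_def)
    finally show False
      using p(2) by simp
  qed
  then show "indep_list [mat 1, A, matrix_inv A]"
    by (simp add: indep_list_3)
next
  assume ind: "indep_list [mat 1, A, matrix_inv A]"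
  have "degree (char_poly3 A) \<le> degree q" if q: "lead_coeff q = 1" "mat_poly q A = 0" for q
  proof (rule ccontr)
    assume "\<not> degree (char_poly3 A) \<le> degree q"
    then have d: "degree q \<le> 2"
      by (simp add: char_poly3_def)
    have "(coeff q 0 - coeff q 2 * sigma2 A) *\<^sub>m mat 1
        + (coeff q 1 + coeff q 2 * trace A) *\<^sub>m A + coeff q 2 *\<^sub>m matrix_inv A = mat_poly q A"
      by (simp add: mat_poly_2[OF d] SL3_square[OF A] cmat.scale_left_diff_distrib
          cmat.scale_left_distrib cmat.scale_right_distrib cmat.scale_right_diff_distrib algebra_simps)
    with ind q(2) have "coeff q 0 - coeff q 2 * sigma2 A = 0 \<and> coeff q 1 + coeff q 2 * trace A = 0
        \<and> coeff q 2 = 0"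
      unfolding indep_list_3 by metis
    then have "coeff q 0 = 0" "coeff q 1 = 0" "coeff q 2 = 0"
      by auto
    moreover have "degree q = 0 \<or> degree q = 1 \<or> degree q = 2"
      using d by linarith
    ultimately show False
      using q(1) by auto
  qed
  then have "is_min_poly (char_poly3 A) A"
    using mat_poly_char_poly3[of A] by (auto simp: is_min_poly_def char_poly3_def)
  moreover have "degree (char_poly3 A) = 3"
    by (simp add: char_poly3_def)
  ultimately show "ordinary A"
    using A by (auto simp: ordinary_def)
qed

section \<open>Irreducible pairs\<close>

lemma smult_mat_mult_vec: "(k *\<^sub>m A) *v v = k *s (A *v v)"
  by (simp add: vec_eq_iff matrix_vector_mult_def sum_distrib_left mult.assoc)

lemma matrix_inv_invariant:
  assumes "A \<in> SL3" and "vec.subspace V" and inv: "\<And>v. v \<in> V \<Longrightarrow> A *v v \<in> V" and "v \<in> V"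
  shows "matrix_inv A *v v \<in> V"
proof -
  have "matrix_inv A *v v = A *v (A *v v) - trace A *s (A *v v) + sigma2 A *s v"
    by (simp add: matrix_inv_eq[OF assms(1)] matrix_vector_mult_add_rdistrib
        matrix_vector_mult_diff_rdistrib smult_mat_mult_vec matrix_vector_mul_assoc)
  also have "\<dots> \<in> V"
    by (intro vec.subspace_add vec.subspace_diff vec.subspace_scale inv assms)
  finally show ?thesis .
qed

text \<open>Invariance under \<open>a\<close> and \<open>b\<close> extends to their inverses, which
  are polynomials in them, and then letter by letter to all words.\<close>

lemma irreducible_pairD:
  assumes irr: "irreducible_pair a b" and a: "a \<in> SL3" and b: "b \<in> SL3"
    and V: "vec.subspace V" and Va: "\<And>v. v \<in> V \<Longrightarrow> a *v v \<in> V" and Vb: "\<And>v. v \<in> V \<Longrightarrow> b *v v \<in> V"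
  shows "V = {0} \<or> V = UNIV"
proof -
  have "eval_letter a b l *v v \<in> V" if "v \<in> V" for l v
    using that Va Vb matrix_inv_invariant[OF a V Va] matrix_inv_invariant[OF b V Vb]
    by (cases l) simp_all
  then have "eval_word a b w *v v \<in> V" if "v \<in> V" for w v
    using that by (induction w) (simp_all add: eval_word_def flip: matrix_vector_mul_assoc)
  with irr V show ?thesis
    by (auto simp: irreducible_pair_def)
qed

lemma eigenvector_exists:
  fixes c :: mat3
  obtains k v where "v \<noteq> 0" and "c *v v = k *s v"
proof -
  have "\<not> constant (poly (char_poly3 c))"
    by (simp add: constant_degree char_poly3_def)
  then obtain k where "poly (char_poly3 c) k = 0"
    using fundamental_theorem_of_algebra by blast
  moreover have "det (c - k *\<^sub>m mat 1) = - poly (char_poly3 c) k"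
    by (simp add: det_3 mat_nth char_poly3_def sigma2_def trace_mat3 algebra_simps)
  ultimately have "\<not> invertible (c - k *\<^sub>m mat 1)"
    by (simp add: invertible_det_nz)
  then obtain v where "v \<noteq> 0" "(c - k *\<^sub>m mat 1) *v v = 0"
    by (metis invertible_left_inverse matrix_left_invertible_ker)
  then show thesis
    by (intro that[of v k]) (simp_all add: matrix_vector_mult_diff_rdistrib smult_mat_mult_vec)
qed

text \<open>Schur's lemma: an eigenspace of \<open>c\<close> is nonzero and invariant under
  \<open>a\<close> and \<open>b\<close>, hence the whole space.\<close>

lemma irreducible_pair_schur:
  assumes irr: "irreducible_pair a b" and a: "a \<in> SL3" and b: "b \<in> SL3"
    and ca: "c ** a = a ** c" and cb: "c ** b = b ** c"
  obtains k where "c = k *\<^sub>m mat 1"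
proof -
  obtain k v where v: "v \<noteq> 0" "c *v v = k *s v"
    by (rule eigenvector_exists)
  define V where "V = {w. c *v w = k *s w}"
  have "V = {0} \<or> V = UNIV"
  proof (rule irreducible_pairD[OF irr a b])
    show "vec.subspace V"
      by (simp add: vec.subspace_def V_def matrix_vector_right_distrib vec.scale_right_distrib
          vec.scale_left_commute vec.scale)
    show "a *v w \<in> V" if "w \<in> V" for w
      using that ca by (simp add: V_def matrix_vector_mul_assoc vec.scale)
        (simp add: vec.scale flip: matrix_vector_mul_assoc)
    show "b *v w \<in> V" if "w \<in> V" for w
      using that cb by (simp add: V_def matrix_vector_mul_assoc vec.scale)
        (simp add: vec.scale flip: matrix_vector_mul_assoc)
  qed
  then have "V = UNIV"
    using v by (auto simp: V_def)
  then have "c *v w = (k *\<^sub>m mat 1) *v w" for w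
    by (auto simp: V_def smult_mat_mult_vec)
  then have "c = k *\<^sub>m mat 1"
    by (simp add: matrix_eq)
  then show thesis
    by (rule that)
qed

text \<open>Otherwise Schur's lemma makes both matrices scalar; then every matrix commutes with both
  and is scalar in turn, which the matrix unit \<open>?c\<close> is not.\<close>

lemma irreducible_pair_not_commute:
  assumes irr: "irreducible_pair a b" and a: "a \<in> SL3" and b: "b \<in> SL3"
  shows "a ** b \<noteq> b ** a"
proof
  assume ab: "a ** b = b ** a"
  obtain k where k: "a = k *\<^sub>m mat 1"
    by (rule irreducible_pair_schur[OF irr a b, of a]) (use ab in auto)
  obtain l where l: "b = l *\<^sub>m mat 1"
    by (rule irreducible_pair_schur[OF irr a b, of b]) (use ab in auto)
  let ?c = "mat3 0 1 0 0 0 0 0 0 0"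
  obtain m where "?c = m *\<^sub>m mat 1"
    by (rule irreducible_pair_schur[OF irr a b, of ?c]) (auto simp: k l mat_distribs)
  then show False
    by (simp add: mat3_eq_iff mat_nth)
qed

section \<open>Commutators with skew-symmetric matrices\<close>

text \<open>With the entries \<open>p\<close>, \<open>q\<close>, \<open>r\<close> named below,
  \<open>t\<close> is the cross product with the vector n = (-r, q, -p), and \<open>t ** t\<close>
  is n n^T minus a scalar matrix. The linear equations for the entries of \<open>x\<close> are
  solved according to which coordinate of n is nonzero, so n may be isotropic.\<close>

lemma sym_commute_skew:
  assumes t: "t \<in> skew_mats" "t \<noteq> 0" and x: "x \<in> sym_mats" and tx: "t ** x = x ** t"
  obtains c d where "x = c *\<^sub>m mat 1 + d *\<^sub>m (t ** t)"
proof -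
  define p where "p = t$1$2"
  define q where "q = t$1$3"
  define r where "r = t$2$3"
  have t_nth: "t$1$1 = 0" "t$2$2 = 0" "t$3$3 = 0" "t$1$2 = p" "t$2$1 = - p" "t$1$3 = q"
      "t$3$1 = - q" "t$2$3 = r" "t$3$2 = - r"
    using t(1) by (simp_all add: skew_mats_iff p_def q_def r_def)
  have pqr: "p \<noteq> 0 \<or> q \<noteq> 0 \<or> r \<noteq> 0"
    using t(2) by (auto simp: mat3_eq_iff t_nth)
  have x_nth: "x$2$1 = x$1$2" "x$3$1 = x$1$3" "x$3$2 = x$2$3"
    using x by (simp_all add: sym_mats_iff)
  define x1 x2 x3 x4 x5 x6 where xs: "x1 = x$1$1" "x2 = x$2$2" "x3 = x$3$3"
    "x4 = x$1$2" "x5 = x$1$3" "x6 = x$2$3"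
  have eqs: "p * x4 + q * x5 = 0" "r * x6 - p * x4 = 0"
      "p * x2 + q * x6 = p * x1 - r * x5"
      "p * x6 + q * x3 = q * x1 + r * x4"
      "- p * x5 + r * x3 = q * x4 + r * x2"
    using tx unfolding mat3_eq_iff mat_mult_nth t_nth x_nth xs[symmetric] by algebra+
  have "\<exists>c d. x1 = c - d * (p * p + q * q) \<and> x2 = c - d * (p * p + r * r) \<and>
      x3 = c - d * (q * q + r * r) \<and> x4 = - d * q * r \<and> x5 = d * p * r \<and> x6 = - d * p * q"
    using pqr
  proof (elim disjE)
    assume "p \<noteq> 0"
    then obtain P where P: "p * P = 1" by (metis right_inverse)
    \<comment> \<open>The value is forced: for \<open>x\<close> of the desired form,
      \<open>2 * x3 - x1 - x2\<close> equals \<open>d * (2 * p * p - q * q - r * r)\<close> and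
      \<open>(x5 * r - x6 * q) * P\<close> equals \<open>d * (q * q + r * r)\<close>. The other two
      cases are analogous.\<close>
    define d where "d = (2 * x3 - x1 - x2 + (x5 * r - x6 * q) * P) * P * P / 2"
    have d2: "2 * d = (2 * x3 - x1 - x2 + (x5 * r - x6 * q) * P) * P * P"
      by (simp add: d_def)
    have "x4 = - d * q * r \<and> x5 = d * p * r \<and> x6 = - d * p * q"
      "x1 = x3 + d * (q * q + r * r) - d * (p * p + q * q)"
      "x2 = x3 + d * (q * q + r * r) - d * (p * p + r * r)"
      using eqs P d2 by algebra+
    then show ?thesis
      by (intro exI[of _ "x3 + d * (q * q + r * r)"] exI[of _ d]) simp
  next
    assume "q \<noteq> 0"
    then obtain Q where Q: "q * Q = 1" by (metis right_inverse)
    define d where "d = (2 * x2 - x1 - x3 - (x4 * r + x6 * p) * Q) * Q * Q / 2"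
    have d2: "2 * d = (2 * x2 - x1 - x3 - (x4 * r + x6 * p) * Q) * Q * Q"
      by (simp add: d_def)
    have "x4 = - d * q * r \<and> x5 = d * p * r \<and> x6 = - d * p * q"
      "x1 = x2 + d * (p * p + r * r) - d * (p * p + q * q)"
      "x3 = x2 + d * (p * p + r * r) - d * (q * q + r * r)"
      using eqs Q d2 by algebra+
    then show ?thesis
      by (intro exI[of _ "x2 + d * (p * p + r * r)"] exI[of _ d]) simp
  next
    assume "r \<noteq> 0"
    then obtain R where R: "r * R = 1" by (metis right_inverse)
    define d where "d = (2 * x1 - x2 - x3 + (x5 * p - x4 * q) * R) * R * R / 2"
    have d2: "2 * d = (2 * x1 - x2 - x3 + (x5 * p - x4 * q) * R) * R * R"
      by (simp add: d_def)
    have "x4 = - d * q * r \<and> x5 = d * p * r \<and> x6 = - d * p * q"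
      "x2 = x1 + d * (p * p + q * q) - d * (p * p + r * r)"
      "x3 = x1 + d * (p * p + q * q) - d * (q * q + r * r)"
      using eqs R d2 by algebra+
    then show ?thesis
      by (intro exI[of _ "x1 + d * (p * p + q * q)"] exI[of _ d]) simp
  qed
  then obtain c d where "x1 = c - d * (p * p + q * q)" "x2 = c - d * (p * p + r * r)"
      "x3 = c - d * (q * q + r * r)" "x4 = - d * q * r" "x5 = d * p * r" "x6 = - d * p * q"
    by blast
  then have "x = c *\<^sub>m mat 1 + d *\<^sub>m (t ** t)"
    unfolding mat3_eq_iff by (simp add: mat_mult_nth t_nth x_nth mat_nth flip: xs) (simp add: algebra_simps)
  then show thesis
    by (rule that)
qed

text \<open>All three matrices lie in the span of \<open>mat 1\<close> and
  \<open>t ** t\<close>.\<close>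

lemma sym_commute_skew_dependent:
  assumes t: "t \<in> skew_mats" "t \<noteq> 0" and x: "x \<in> sym_mats" "t ** x = x ** t"
    and y: "y \<in> sym_mats" "t ** y = y ** t"
  shows "\<not> indep_list [mat 1, x, y]"
proof
  assume ind: "indep_list [mat 1, x, y]"
  obtain c d where cd: "x = c *\<^sub>m mat 1 + d *\<^sub>m (t ** t)"
    using sym_commute_skew[OF t x] .
  obtain c' d' where cd': "y = c' *\<^sub>m mat 1 + d' *\<^sub>m (t ** t)"
    using sym_commute_skew[OF t y] .
  \<comment> \<open>This combination eliminates \<open>t ** t\<close>. Independence forces
    \<open>d = 0\<close>, and then \<open>x\<close> itself is scalar.\<close>
  have "(d * c' - d' * c) *\<^sub>m mat 1 + d' *\<^sub>m x + (- d) *\<^sub>m y = 0"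
    by (simp add: cd cd' mat3_eq_iff algebra_simps)
  then have "d = 0"
    using ind unfolding indep_list_3 by (metis neg_equal_0_iff_equal)
  then have "(- c) *\<^sub>m mat 1 + 1 *\<^sub>m x + 0 *\<^sub>m y = 0"
    by (simp add: cd mat3_eq_iff)
  then show False
    using ind unfolding indep_list_3 by (metis one_neq_zero)
qed

text \<open>Transposition preserves the trace, reverses the product and changes the sign of
  \<open>s\<close>; cyclic rotation restores the position of \<open>s\<close>.\<close>

lemma trace_skew_sym_sym:
  assumes "s \<in> skew_mats" and "x \<in> sym_mats" and "y \<in> sym_mats"
  shows "trace (s ** (x ** y)) = - trace (s ** (y ** x))"
  using assms by (simp add: trace_mat3 mat_mult_nth sym_mats_iff skew_mats_iff algebra_simps)

lemma trace_skew_sym: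
  assumes "s \<in> skew_mats" and "x \<in> sym_mats"
  shows "trace (s ** x) = 0"
  using assms by (simp add: trace_mat3 mat_mult_nth sym_mats_iff skew_mats_iff algebra_simps)

lemma trace_skew_sym_self:
  assumes "s \<in> skew_mats" and "x \<in> sym_mats"
  shows "trace (s ** (x ** x)) = 0"
  using trace_skew_sym_sym[OF assms assms(2)] by simp

lemma trace_sym_sym_sym:
  assumes "q \<in> sym_mats" and "x \<in> sym_mats" and "y \<in> sym_mats"
  shows "trace (q ** (x ** y)) = trace (q ** (y ** x))"
  using assms by (simp add: trace_mat3 mat_mult_nth sym_mats_iff skew_mats_iff algebra_simps)

lemma commutator_skew_sym:
  assumes "s \<in> skew_mats" and "x \<in> sym_mats"
  shows "x ** s - s ** x \<in> sym_mats"
  using assms by (simp add: sym_mats_iff skew_mats_iff mat_mult_nth algebra_simps)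

lemma commutator_sym_sym:
  assumes "x \<in> sym_mats" and "y \<in> sym_mats"
  shows "x ** y - y ** x \<in> skew_mats"
  using assms by (simp add: sym_mats_iff skew_mats_iff mat_mult_nth algebra_simps)

text \<open>Adjointness of the commutator for the trace form: the functional of the commutator on
  symmetric matrices is expressed through \<open>s\<close>.\<close>

lemma trace_commutator:
  assumes "s \<in> skew_mats" and "x \<in> sym_mats" and "y \<in> sym_mats"
  shows "trace ((x ** s - s ** x) ** y) = - 2 * trace (s ** (x ** y))"
proof -
  have "trace (x ** s ** y) = trace (s ** (y ** x))"
    by (metis matrix_mul_assoc trace_mul_sym)
  then show ?thesis
    using trace_skew_sym_sym[OF assms] by (simp add: mat_distribs trace_sub matrix_mul_assoc)
qed

text \<open>After \<open>x ** x\<close> is expanded by \<open>SL3_square\<close>, the term in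
  \<open>x ** z\<close> vanishes by the hypothesis on the trace and the term in \<open>z\<close> by
  symmetry. Only the inverse of \<open>x\<close> remains.\<close>

lemma trace_commutator_mult:
  assumes x: "x \<in> SL3" "x \<in> sym_mats" and s: "s \<in> skew_mats" and z: "z \<in> sym_mats"
    and 0: "trace ((x ** s - s ** x) ** z) = 0"
  shows "trace ((x ** s - s ** x) ** (x ** z)) = - trace (s ** (matrix_inv x ** z))"
proof -
  \<comment> \<open>This symmetric product is orthogonal to \<open>s\<close>, which leaves only the
    term with \<open>x ** x\<close>.\<close>
  have "x ** (z ** x) \<in> sym_mats"
    using x(2) z by (simp add: sym_mats_def matrix_transpose_mul matrix_mul_assoc)
  then have "trace (s ** (x ** (z ** x))) = 0"
    using s by (rule trace_skew_sym[rotated])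
  moreover have "trace (x ** s ** (x ** z)) = trace (s ** (x ** (z ** x)))"
    by (metis matrix_mul_assoc trace_mul_sym)
  moreover have "s ** x ** (x ** z) = s ** (x ** x ** z)"
    by (simp add: matrix_mul_assoc)
  ultimately have "trace ((x ** s - s ** x) ** (x ** z)) = - trace (s ** (x ** x ** z))"
    by (simp add: mat_distribs trace_sub)
  also have "\<dots> = - (trace x * trace (s ** (x ** z)) - sigma2 x * trace (s ** z)
      + trace (s ** (matrix_inv x ** z)))"
    by (simp add: SL3_square[OF x(1)] mat_distribs trace_add trace_sub trace_smult)
  also have "\<dots> = - trace (s ** (matrix_inv x ** z))"
    using 0 trace_commutator[OF s x(2) z] trace_skew_sym[OF s z] by simp
  finally show ?thesis .
qed

text \<open>Pairing with the standard generators returns the entries of \<open>q\<close>, the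
  off-diagonal ones doubled.\<close>

lemma sym_mats_trace_nondegenerate:
  assumes q: "q \<in> sym_mats" and 0: "\<And>z. z \<in> sym_mats \<Longrightarrow> trace (q ** z) = 0"
  shows "q = 0"
proof -
  have "trace (q ** mat3 1 0 0 0 0 0 0 0 0) = 0" "trace (q ** mat3 0 0 0 0 1 0 0 0 0) = 0"
    "trace (q ** mat3 0 0 0 0 0 0 0 0 1) = 0" "trace (q ** mat3 0 1 0 1 0 0 0 0 0) = 0"
    "trace (q ** mat3 0 0 1 0 0 0 1 0 0) = 0" "trace (q ** mat3 0 0 0 0 0 1 0 1 0) = 0"
    by (rule 0, simp add: sym_mats_iff)+
  then show ?thesis
    using q by (simp add: trace_mat3 mat_mult_nth sym_mats_iff mat3_eq_iff)
qed

text \<open>The commutators \<open>[a, s]\<close> and \<open>[b, t]\<close> lie in the five-dimensional space of traceless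
  symmetric matrices, while \<open>(s, t)\<close> ranges over a six-dimensional space.\<close>

lemma common_skew_commutator:
  assumes a: "a \<in> sym_mats" and b: "b \<in> sym_mats"
  obtains s t where "s \<in> skew_mats" and "t \<in> skew_mats" and "s \<noteq> 0 \<or> t \<noteq> 0"
    and "a ** s - s ** a = b ** t - t ** b"
proof -
  define g h k where ghk: "g = mat3 0 1 0 (-1) 0 0 0 0 0" "h = mat3 0 0 1 0 0 0 (-1) 0 0"
    "k = mat3 0 0 0 0 0 1 0 (-1) 0"
  have gs: "g \<in> skew_mats" "h \<in> skew_mats" "k \<in> skew_mats"
    by (simp_all add: ghk skew_mats_iff)
  have ind: "c = 0 \<and> d = 0 \<and> e = 0" if "c *\<^sub>m g + d *\<^sub>m h + e *\<^sub>m k = 0" for c d e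
    using that by (simp add: ghk mat3_eq_iff)
  define A where "A x = a ** x - x ** a" for x :: mat3
  define B where "B x = b ** x - x ** b" for x :: mat3
  let ?xs = "[A g, A h, A k, B g, B h, B k]"
  have "A x \<in> {A \<in> sym_mats. trace A = 0}" "B x \<in> {A \<in> sym_mats. trace A = 0}"
    if "x \<in> skew_mats" for x
    using that a b commutator_skew_sym
    by (auto simp: A_def B_def trace_sub trace_mul_sym[of x])
  then have "set ?xs \<subseteq> {A \<in> sym_mats. trace A = 0}"
    using gs by simp
  then have "\<not> indep_list ?xs"
    using indep_list_length_le[of ?xs traceless_sym_gens] traceless_sym_mats_subset_span
    by (auto simp: traceless_sym_gens_def)
  moreover have len: "length ?xs = 6"
    by simp
  ultimately obtain c i
    where 0: "(\<Sum>i<6. c i *\<^sub>m ?xs ! i) = 0" and i: "i < 6" "c i \<noteq> (0::complex)"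
    unfolding indep_list_def len by blast
  \<comment> \<open>The dependence splits into an \<open>A\<close> part and a \<open>B\<close> part;
    the minus signs in \<open>t\<close> move the latter to the other side.\<close>
  define s where "s = c 0 *\<^sub>m g + c 1 *\<^sub>m h + c 2 *\<^sub>m k"
  define t where "t = (- c 3) *\<^sub>m g + (- c 4) *\<^sub>m h + (- c 5) *\<^sub>m k"
  have "A s - B t = (\<Sum>i<6. c i *\<^sub>m ?xs ! i)"
    by (simp add: A_def B_def s_def t_def mat_distribs eval_nat_numeral
        cmat.scale_right_diff_distrib algebra_simps)
  with 0 have "A s = B t"
    by simp
  moreover have "s \<in> skew_mats" "t \<in> skew_mats"
    unfolding s_def t_def
    by (intro cmat.subspace_add cmat.subspace_scale subspace_skew_mats gs)+
  moreover have "s \<noteq> 0 \<or> t \<noteq> 0"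
  proof (rule ccontr)
    assume "\<not> (s \<noteq> 0 \<or> t \<noteq> 0)"
    then have "c 0 = 0 \<and> c 1 = 0 \<and> c 2 = 0" "- c 3 = 0 \<and> - c 4 = 0 \<and> - c 5 = 0"
      using ind unfolding s_def t_def by blast+
    moreover have "i = 0 \<or> i = 1 \<or> i = 2 \<or> i = 3 \<or> i = 4 \<or> i = 5"
      using i(1) by linarith
    ultimately show False
      using i(2) by auto
  qed
  ultimately show thesis
    using that by (auto simp: A_def B_def)
qed

section \<open>Pairs of ordinary symmetric matrices\<close>

lemma indep_list_6I:
  assumes "\<And>c1 c2 c3 c4 c5 c6. c1 *\<^sub>m x1 + c2 *\<^sub>m x2 + c3 *\<^sub>m x3 + c4 *\<^sub>m x4 + c5 *\<^sub>m x5
      + c6 *\<^sub>m x6 = 0 \<Longrightarrow> c1 = 0 \<and> c2 = 0 \<and> c3 = 0 \<and> c4 = 0 \<and> c5 = 0 \<and> c6 = 0"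
  shows "indep_list [x1, x2, x3, x4, x5, x6]"
  using assms by (simp add: indep_list_def All_less_Suc)

lemma indep_list_9I:
  assumes "\<And>c1 c2 c3 c4 c5 c6 c7 c8 c9. c1 *\<^sub>m x1 + c2 *\<^sub>m x2 + c3 *\<^sub>m x3 + c4 *\<^sub>m x4
      + c5 *\<^sub>m x5 + c6 *\<^sub>m x6 + c7 *\<^sub>m x7 + c8 *\<^sub>m x8 + c9 *\<^sub>m x9 = 0
      \<Longrightarrow> c1 = 0 \<and> c2 = 0 \<and> c3 = 0 \<and> c4 = 0 \<and> c5 = 0 \<and> c6 = 0 \<and> c7 = 0 \<and> c8 = 0 \<and> c9 = 0"
  shows "indep_list [x1, x2, x3, x4, x5, x6, x7, x8, x9]"
  using assms by (simp add: indep_list_def All_less_Suc)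

lemmas smult_mat_distribs = cmat.scale_left_distrib cmat.scale_right_distrib
  cmat.scale_left_diff_distrib cmat.scale_right_diff_distrib

lemma commute_matrix_inv_iff:
  assumes "A \<in> SL3"
  shows "C ** matrix_inv A = matrix_inv A ** C \<longleftrightarrow> C ** A = A ** C"
  using commute_matrix_inv[OF assms] commute_matrix_inv[of "matrix_inv A"] SL3_inverse[OF assms]
  by metis

lemma indep_list_3_swap:
  assumes "indep_list [x, y, z]"
  shows "indep_list [x, z, y]"
  unfolding indep_list_3
proof (intro allI impI)
  fix c d e assume "c *\<^sub>m x + d *\<^sub>m z + e *\<^sub>m y = 0"
  then have "c *\<^sub>m x + e *\<^sub>m y + d *\<^sub>m z = 0"
    by (simp add: add_ac)
  with assms show "c = 0 \<and> d = 0 \<and> e = 0"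
    unfolding indep_list_3 by blast
qed

text \<open>Irreducibility enters through the commutant condition \<open>scalar\<close>, which
  passes to the pair of \<open>matrix_inv a\<close> and \<open>b\<close>.\<close>

locale ordinary_sym_pair =
  fixes a b :: mat3
  assumes a: "a \<in> SL3" "a \<in> sym_mats" "indep_list [mat 1, a, matrix_inv a]"
    and b: "b \<in> SL3" "b \<in> sym_mats" "indep_list [mat 1, b, matrix_inv b]"
    and scalar: "\<And>c. c ** a = a ** c \<Longrightarrow> c ** b = b ** c \<Longrightarrow> \<exists>k. c = k *\<^sub>m mat 1"
begin

abbreviation "ai \<equiv> matrix_inv a"
abbreviation "bi \<equiv> matrix_inv b"

lemma inverse_pair: "ordinary_sym_pair ai b"
  using a b scalar SL3_inverse[OF a(1)] indep_list_3_swap matrix_inv_sym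
  by unfold_locales (auto simp: commute_matrix_inv_iff)

lemma inv_sym: "ai \<in> sym_mats" "bi \<in> sym_mats" "mat 1 \<in> sym_mats"
  using a b by (auto simp: matrix_inv_sym) (simp add: sym_mats_def)

text \<open>A polynomial in \<open>a\<close> that is also a polynomial in \<open>b\<close> commutes
  with both and is therefore scalar.\<close>

lemma indep5:
  assumes 0: "c1 *\<^sub>m mat 1 + c2 *\<^sub>m a + c3 *\<^sub>m ai + c4 *\<^sub>m b + c5 *\<^sub>m bi = 0"
  shows "c1 = 0 \<and> c2 = 0 \<and> c3 = 0 \<and> c4 = 0 \<and> c5 = 0"
proof -
  define y where "y = c4 *\<^sub>m b + c5 *\<^sub>m bi"
  have y: "y = - (c1 *\<^sub>m mat 1 + c2 *\<^sub>m a + c3 *\<^sub>m ai)"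
    using 0 by (simp add: y_def eq_neg_iff_add_eq_0 algebra_simps)
  have "y ** a = a ** y"
    by (simp add: y mat_distribs SL3_inverse[OF a(1)])
  moreover have "y ** b = b ** y"
    by (simp add: y_def mat_distribs SL3_inverse[OF b(1)])
  ultimately obtain k where k: "y = k *\<^sub>m mat 1"
    using scalar by blast
  have "(c1 + k) *\<^sub>m mat 1 + c2 *\<^sub>m a + c3 *\<^sub>m ai = 0"
    using y unfolding k by (simp add: smult_mat_distribs eq_neg_iff_add_eq_0 algebra_simps)
  moreover have "(- k) *\<^sub>m mat 1 + c4 *\<^sub>m b + c5 *\<^sub>m bi = 0"
    using k by (simp add: y_def algebra_simps)
  ultimately have "c1 + k = 0 \<and> c2 = 0 \<and> c3 = 0" "- k = 0 \<and> c4 = 0 \<and> c5 = 0"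
    using a(3) b(3) unfolding indep_list_3 by blast+
  then show ?thesis
    by auto
qed

text \<open>The orthogonal complement, for the trace form on symmetric matrices, of the sum of the
  algebras generated by \<open>a\<close> and \<open>b\<close>.\<close>

definition orth5 :: "mat3 \<Rightarrow> bool" where
  "orth5 q \<longleftrightarrow> q \<in> sym_mats \<and> trace q = 0 \<and> trace (q ** a) = 0 \<and> trace (q ** ai) = 0 \<and>
     trace (q ** b) = 0 \<and> trace (q ** bi) = 0"

text \<open>Pairing the relation with \<open>q\<close> annihilates the first five terms and isolates
  \<open>c6\<close>.\<close>

lemma indep6:
  assumes q: "orth5 q" and z: "trace (q ** z) \<noteq> 0"
    and 0: "c1 *\<^sub>m mat 1 + c2 *\<^sub>m a + c3 *\<^sub>m ai + c4 *\<^sub>m b + c5 *\<^sub>m bi + c6 *\<^sub>m z = 0"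
  shows "c1 = 0 \<and> c2 = 0 \<and> c3 = 0 \<and> c4 = 0 \<and> c5 = 0 \<and> c6 = 0"
proof -
  have "trace (q ** (c1 *\<^sub>m mat 1 + c2 *\<^sub>m a + c3 *\<^sub>m ai + c4 *\<^sub>m b + c5 *\<^sub>m bi + c6 *\<^sub>m z)) = 0"
    unfolding 0 by (simp add: mat_distribs trace_zero)
  then have "c6 = 0"
    using q z by (simp add: mat_distribs trace_add trace_smult orth5_def)
  with 0 indep5[of c1 c2 c3 c4 c5] show ?thesis
    by simp
qed

lemma is_basis_sym:
  assumes "orth5 q" and "trace (q ** z) \<noteq> 0" and "z \<in> sym_mats"
  shows "is_basis [mat 1, a, ai, b, bi, z] sym_mats"
  by (rule is_basis_symI[OF indep_list_6I[OF indep6[OF assms(1,2)]]])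
    (use assms(3) a(2) b(2) inv_sym in simp_all)

text \<open>For a nondegenerate form, the complement of a hyperplane is a line.\<close>

lemma orth5_unique:
  assumes q: "orth5 q" "q \<noteq> 0" and p: "orth5 p"
  obtains k where "p = k *\<^sub>m q"
proof -
  obtain z where z: "z \<in> sym_mats" "trace (q ** z) \<noteq> 0"
    using sym_mats_trace_nondegenerate[of q] q by (auto simp: orth5_def)
  \<comment> \<open>This choice makes \<open>r\<close> orthogonal to \<open>z\<close> as well, hence
    to a basis of the symmetric matrices.\<close>
  define k where "k = trace (p ** z) / trace (q ** z)"
  define r where "r = p - k *\<^sub>m q"
  have span: "cmat.span {mat 1, a, ai, b, bi, z} = sym_mats"
    using is_basis_sym[OF q(1) z(2,1)] by (simp add: is_basis_def)
  have "cmat.subspace {y. trace (r ** y) = 0}"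
    by (simp add: cmat.subspace_def mat_distribs trace_add trace_smult trace_zero)
  moreover have "{mat 1, a, ai, b, bi, z} \<subseteq> {y. trace (r ** y) = 0}"
    using q(1) p z by (auto simp: orth5_def r_def k_def mat_distribs trace_sub trace_smult)
  ultimately have "sym_mats \<subseteq> {y. trace (r ** y) = 0}"
    unfolding span[symmetric] by (rule cmat.span_minimal[rotated])
  moreover have "r \<in> sym_mats"
    using p q(1) unfolding r_def orth5_def
    by (auto intro!: cmat.subspace_diff cmat.subspace_scale subspace_sym_mats)
  ultimately have "r = 0"
    using sym_mats_trace_nondegenerate by blast
  then show thesis
    by (intro that[of k]) (simp add: r_def)
qed

text \<open>A nonzero \<open>s\<close> commuting with an ordinary symmetric matrix also commutes
  with its inverse, which would make \<open>mat 1\<close> and these two matrices dependent.\<close>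

lemma skew_commute_zero:
  "s \<in> skew_mats \<Longrightarrow> a ** s = s ** a \<Longrightarrow> s = 0"
  "s \<in> skew_mats \<Longrightarrow> b ** s = s ** b \<Longrightarrow> s = 0"
  using sym_commute_skew_dependent[of s a ai] sym_commute_skew_dependent[of s b bi]
    a b inv_sym commute_matrix_inv by metis+

end

section \<open>Trace functionals attached to a common commutator\<close>

locale ordinary_sym_pair_commutators = ordinary_sym_pair +
  fixes s t q :: mat3
  assumes s: "s \<in> skew_mats" "a ** s - s ** a = q" and t: "t \<in> skew_mats" "b ** t - t ** b = q"
    and nonzero: "s \<noteq> 0 \<or> t \<noteq> 0"
begin

lemma trace_q:
  assumes "y \<in> sym_mats"
  shows "trace (q ** y) = - 2 * trace (s ** (a ** y))" "trace (q ** y) = - 2 * trace (t ** (b ** y))"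
  using trace_commutator[OF s(1) a(2) assms] trace_commutator[OF t(1) b(2) assms]
  by (simp_all add: s(2) t(2))

lemma q_sym: "q \<in> sym_mats"
  using commutator_skew_sym[OF s(1) a(2)] by (simp add: s(2))

text \<open>Against polynomials in \<open>a\<close>, view \<open>q\<close> as a commutator with
  \<open>s\<close>; against polynomials in \<open>b\<close>, as a commutator with \<open>t\<close>.
  Each pairing becomes the trace of a skew-symmetric times a symmetric matrix.\<close>

lemma orth5_q: "orth5 q"
proof -
  have skew0: "trace u = 0" if "u \<in> skew_mats" for u
    using trace_skew_sym[OF that inv_sym(3)] by simp
  have "trace (q ** mat 1) = 0"
    using trace_q(1)[OF inv_sym(3)] trace_skew_sym[OF s(1) a(2)] by simp
  moreover have "trace (q ** a) = 0" "trace (q ** ai) = 0"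
    using trace_q(1)[OF a(2)] trace_q(1)[OF inv_sym(1)] trace_skew_sym_self[OF s(1) a(2)]
      skew0[OF s(1)] SL3_inverse[OF a(1)] by simp_all
  moreover have "trace (q ** b) = 0" "trace (q ** bi) = 0"
    using trace_q(2)[OF b(2)] trace_q(2)[OF inv_sym(2)] trace_skew_sym_self[OF t(1) b(2)]
      skew0[OF t(1)] SL3_inverse[OF b(1)] by simp_all
  ultimately show ?thesis
    using q_sym by (simp add: orth5_def)
qed

text \<open>If \<open>q\<close> vanished, \<open>s\<close> would commute with \<open>a\<close> and
  \<open>t\<close> with \<open>b\<close>, so both would be zero; and \<open>t = 0\<close> forces
  \<open>q = 0\<close>.\<close>

lemma q_nonzero: "q \<noteq> 0" and t_nonzero: "t \<noteq> 0"
  using skew_commute_zero s t nonzero by (auto simp: mat_distribs)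

lemma trace_q_a_mult:
  assumes "y \<in> sym_mats" and "trace (q ** y) = 0"
  shows "trace (q ** (a ** y)) = - trace (s ** (ai ** y))"
  using trace_commutator_mult[OF a(1,2) s(1) assms(1)] assms(2) by (simp add: s(2))

lemma trace_q_b_mult:
  assumes "y \<in> sym_mats" and "trace (q ** y) = 0"
  shows "trace (q ** (y ** b)) = - trace (t ** (bi ** y))"
  using trace_commutator_mult[OF b(1,2) t(1) assms(1)] assms(2)
    trace_sym_sym_sym[OF q_sym assms(1) b(2)] by (simp add: t(2))

lemma trace_q_a_b_nonzero: "trace (q ** (a ** b)) \<noteq> 0 \<or> trace (q ** (ai ** b)) \<noteq> 0"
proof (rule ccontr)
  assume "\<not> ?thesis"
  \<comment> \<open>The two vanishing traces, expressed through \<open>t\<close>. Together with the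
    next pair, they make the commutators of \<open>a\<close> and \<open>ai\<close> with
    \<open>t\<close> orthogonal to \<open>b\<close> and \<open>bi\<close>.\<close>
  then have 0: "trace (t ** (bi ** a)) = 0" "trace (t ** (bi ** ai)) = 0"
    using trace_q_b_mult[OF a(2)] trace_q_b_mult[OF inv_sym(1)] orth5_q by (auto simp: orth5_def)
  have 1: "trace (t ** (b ** a)) = 0" "trace (t ** (b ** ai)) = 0"
    using trace_q(2)[OF a(2)] trace_q(2)[OF inv_sym(1)] orth5_q by (auto simp: orth5_def)
  have skew0: "trace t = 0"
    using trace_skew_sym[OF t(1) inv_sym(3)] by simp
  have "orth5 (x ** t - t ** x)" if x: "x = a \<or> x = ai" for x
  proof -
    have xs: "x \<in> sym_mats"
      using x a inv_sym by auto
    note tr = trace_commutator[OF t(1) xs]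
    have "trace ((x ** t - t ** x) ** mat 1) = 0"
      using tr[OF inv_sym(3)] trace_skew_sym[OF t(1) xs] by simp
    moreover have "trace ((x ** t - t ** x) ** a) = 0" "trace ((x ** t - t ** x) ** ai) = 0"
      using tr[OF a(2)] tr[OF inv_sym(1)] x skew0 trace_skew_sym_self[OF t(1) xs]
        SL3_inverse[OF a(1)] by auto
    moreover have "trace ((x ** t - t ** x) ** b) = 0" "trace ((x ** t - t ** x) ** bi) = 0"
      using tr[OF b(2)] tr[OF inv_sym(2)] trace_skew_sym_sym[OF t(1) xs b(2)]
        trace_skew_sym_sym[OF t(1) xs inv_sym(2)] x 0 1 by auto
    ultimately show ?thesis
      using commutator_skew_sym[OF t(1) xs] by (simp add: orth5_def)
  qed
  then have orth: "orth5 (a ** t - t ** a)" "orth5 (ai ** t - t ** ai)"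
    by auto
  obtain k where k: "a ** t - t ** a = k *\<^sub>m q"
    using orth5_unique[OF orth5_q q_nonzero orth(1)] .
  obtain l where l: "ai ** t - t ** ai = l *\<^sub>m q"
    using orth5_unique[OF orth5_q q_nonzero orth(2)] .
  \<comment> \<open>Since the commutator of \<open>b\<close> with \<open>t\<close> is
    \<open>q\<close>, these multiples of \<open>b\<close> cancel the commutators with
    \<open>t\<close>.\<close>
  define x where "x = a - k *\<^sub>m b"
  define y where "y = ai - l *\<^sub>m b"
  have "x ** t - t ** x = (a ** t - t ** a) - k *\<^sub>m (b ** t - t ** b)"
    "y ** t - t ** y = (ai ** t - t ** ai) - l *\<^sub>m (b ** t - t ** b)"
    by (simp_all add: x_def y_def mat_distribs smult_mat_distribs)
  then have "t ** x = x ** t" "t ** y = y ** t"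
    by (simp_all add: k l t(2))
  moreover have "x \<in> sym_mats" "y \<in> sym_mats"
    using a(2) b(2) inv_sym unfolding x_def y_def
    by (auto intro!: cmat.subspace_diff cmat.subspace_scale subspace_sym_mats)
  ultimately have "\<not> indep_list [mat 1, x, y]"
    by (intro sym_commute_skew_dependent[OF t(1) t_nonzero])
  then obtain c d e where cde: "c *\<^sub>m mat 1 + d *\<^sub>m x + e *\<^sub>m y = 0" "\<not> (c = 0 \<and> d = 0 \<and> e = 0)"
    unfolding indep_list_3 by blast
  have "c *\<^sub>m mat 1 + d *\<^sub>m a + e *\<^sub>m ai + (- d * k - e * l) *\<^sub>m b + 0 *\<^sub>m bi = 0"
    using cde(1) by (simp add: x_def y_def smult_mat_distribs algebra_simps)
  from indep5[OF this] cde(2) show False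
    by simp
qed

text \<open>The functionals of \<open>s\<close> and \<open>t\<close> both vanish on the commutator
  of \<open>a\<close> and \<open>b\<close>; \<open>s\<close> detects only that of \<open>ai\<close>
  and \<open>b\<close>, and \<open>t\<close> only that of \<open>a\<close> and \<open>bi\<close>.
  The first commutator is nonzero because \<open>a\<close> is not scalar.\<close>

lemma bases:
  assumes nz: "trace (q ** (a ** b)) \<noteq> 0"
  shows "is_basis [mat 1, a, ai, b, bi, a ** b + b ** a] sym_mats"
    and "is_basis [a ** b - b ** a, ai ** b - b ** ai, a ** bi - bi ** a] skew_mats"
    and "is_basis [mat 1, a, ai, b, bi, a ** b, b ** a, ai ** b, a ** bi] UNIV"
proof -
  let ?z = "a ** b + b ** a"
  have zs: "?z \<in> sym_mats"
    using a(2) b(2) by (simp add: sym_mats_iff mat_mult_nth algebra_simps)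
  have tz: "trace (q ** ?z) \<noteq> 0"
    using nz trace_sym_sym_sym[OF q_sym a(2) b(2)] by (simp add: mat_distribs trace_add)
  show sym: "is_basis [mat 1, a, ai, b, bi, ?z] sym_mats"
    by (rule is_basis_sym[OF orth5_q tz zs])
  have ab: "a ** b - b ** a \<noteq> 0"
  proof
    assume "a ** b - b ** a = 0"
    then obtain k where "a = k *\<^sub>m mat 1"
      using scalar[of a] by auto
    then have "k *\<^sub>m mat 1 + (- 1) *\<^sub>m a + 0 *\<^sub>m ai = 0"
      by simp
    then show False
      using a(3) unfolding indep_list_3 by (metis neg_equal_0_iff_equal one_neq_zero)
  qed
  have st: "trace (u ** (x ** y - y ** x)) = 2 * trace (u ** (x ** y))"
    if "u \<in> skew_mats" "x \<in> sym_mats" "y \<in> sym_mats" for u x y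
    using trace_skew_sym_sym[OF that] by (simp add: mat_distribs trace_sub)
  have q0: "trace (q ** a) = 0" "trace (q ** ai) = 0" "trace (q ** b) = 0" "trace (q ** bi) = 0"
    using orth5_q by (auto simp: orth5_def)
  have s_tr: "trace (s ** (a ** b - b ** a)) = 0" "trace (s ** (a ** bi - bi ** a)) = 0"
    "trace (s ** (ai ** b - b ** ai)) \<noteq> 0"
    using st[OF s(1)] a(2) b(2) inv_sym trace_q(1)[OF b(2)] trace_q(1)[OF inv_sym(2)]
      trace_q_a_mult[OF b(2)] nz q0 by auto
  have t_tr: "trace (t ** (a ** b - b ** a)) = 0" "trace (t ** (ai ** b - b ** ai)) = 0"
    "trace (t ** (a ** bi - bi ** a)) \<noteq> 0"
    using st[OF t(1)] a(2) b(2) inv_sym trace_q(2)[OF a(2)] trace_q(2)[OF inv_sym(1)]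
      trace_skew_sym_sym[OF t(1) a(2) b(2)] trace_skew_sym_sym[OF t(1) inv_sym(1) b(2)]
      trace_skew_sym_sym[OF t(1) a(2) inv_sym(2)] trace_q_b_mult[OF a(2)] nz q0 by auto
  have skew_ind: "c = 0 \<and> d = 0 \<and> e = 0"
    if 0: "c *\<^sub>m (a ** b - b ** a) + d *\<^sub>m (ai ** b - b ** ai) + e *\<^sub>m (a ** bi - bi ** a) = 0"
    for c d e
  proof -
    have tr: "c * trace (u ** (a ** b - b ** a)) + d * trace (u ** (ai ** b - b ** ai))
        + e * trace (u ** (a ** bi - bi ** a)) = 0" for u
      using arg_cong[OF 0, of "\<lambda>x. trace (u ** x)"]
      by (simp only: mat_distribs trace_add trace_smult trace_zero)
    have "d = 0" "e = 0"
      using tr[of s] tr[of t] s_tr t_tr by simp_all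
    with 0 ab show ?thesis
      by simp
  qed
  show "is_basis [a ** b - b ** a, ai ** b - b ** ai, a ** bi - bi ** a] skew_mats"
    by (rule is_basis_skewI)
      (use skew_ind commutator_sym_sym a(2) b(2) inv_sym in \<open>auto simp: indep_list_3\<close>)
  have "indep_list [mat 1, a, ai, b, bi, a ** b, b ** a, ai ** b, a ** bi]"
  proof (rule indep_list_9I)
    fix c1 c2 c3 c4 c5 c6 c7 c8 c9
    assume 0: "c1 *\<^sub>m mat 1 + c2 *\<^sub>m a + c3 *\<^sub>m ai + c4 *\<^sub>m b + c5 *\<^sub>m bi + c6 *\<^sub>m (a ** b)
      + c7 *\<^sub>m (b ** a) + c8 *\<^sub>m (ai ** b) + c9 *\<^sub>m (a ** bi) = 0" (is "?L = 0")
    have tp: "transpose a = a" "transpose b = b" "transpose ai = ai" "transpose bi = bi"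
      using a b inv_sym by (auto simp: sym_mats_def)
    \<comment> \<open>Subtracting the transpose isolates the skew-symmetric part; once its
      coefficients vanish, the relation is one between symmetric matrices.\<close>
    have "(c6 - c7) *\<^sub>m (a ** b - b ** a) + c8 *\<^sub>m (ai ** b - b ** ai) + c9 *\<^sub>m (a ** bi - bi ** a)
        = ?L - transpose ?L"
      by (simp add: transpose_distribs matrix_transpose_mul tp smult_mat_distribs)
    also have "\<dots> = 0"
      unfolding 0 by (simp add: transpose_def vec_eq_iff)
    finally have c: "c6 = c7" "c8 = 0" "c9 = 0"
      using skew_ind[of "c6 - c7" c8 c9] by simp_all
    have "c1 *\<^sub>m mat 1 + c2 *\<^sub>m a + c3 *\<^sub>m ai + c4 *\<^sub>m b + c5 *\<^sub>m bi + c6 *\<^sub>m ?z = 0"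
      using 0 by (simp add: c smult_mat_distribs add.assoc)
    from indep6[OF orth5_q tz this] c
    show "c1 = 0 \<and> c2 = 0 \<and> c3 = 0 \<and> c4 = 0 \<and> c5 = 0 \<and> c6 = 0 \<and> c7 = 0 \<and> c8 = 0 \<and> c9 = 0"
      by simp
  qed
  then show "is_basis [mat 1, a, ai, b, bi, a ** b, b ** a, ai ** b, a ** bi] UNIV"
    by (rule is_basis_UNIVI) simp
qed

text \<open>Conjugating by \<open>a\<close> inside the commutator:
  \<open>ai ** (a ** s ** a)\<close> is \<open>s ** a\<close> and \<open>(a ** s ** a) ** ai\<close>
  is \<open>a ** s\<close>, so \<open>q\<close> and \<open>t\<close> are unchanged.\<close>

lemma inverse_commutators: "ordinary_sym_pair_commutators ai b (- (a ** s ** a)) t q"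
proof -
  interpret inv: ordinary_sym_pair ai b
    by (rule inverse_pair)
  show ?thesis
  proof
    show "- (a ** s ** a) \<in> skew_mats"
      using s(1) a(2)
      by (simp add: skew_mats_def sym_mats_def transpose_distribs matrix_transpose_mul mat_distribs
          matrix_mul_assoc)
    have "ai ** (a ** s ** a) = s ** a" "(a ** s ** a) ** ai = a ** s"
      using SL3_inverse[OF a(1)] by (simp add: matrix_mul_assoc, simp flip: matrix_mul_assoc)
    then show "ai ** (- (a ** s ** a)) - (- (a ** s ** a)) ** ai = q"
      using s(2) by (simp add: mat_distribs)
  qed (use t t_nonzero in auto)
qed

end

section \<open>Special symmetric matrices\<close>

text \<open>The rank is at most one, and a complex square root of a nonzero diagonal entry
  normalizes the corresponding row to \<open>u\<close>. If the diagonal vanishes, so do all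
  entries.\<close>

lemma rank_one_sym:
  assumes N: "N \<in> sym_mats" and adj: "N ** N - trace N *\<^sub>m N + sigma2 N *\<^sub>m mat 1 = 0"
  obtains u where "\<And>i j. N $ i $ j = u $ i * u $ (j :: 3)"
proof -
  have N_nth: "N$2$1 = N$1$2" "N$3$1 = N$1$3" "N$3$2 = N$2$3"
    using N by (simp_all add: sym_mats_iff)
  define x1 x2 x3 x4 x5 x6 where xs: "x1 = N$1$1" "x2 = N$2$2" "x3 = N$3$3"
    "x4 = N$1$2" "x5 = N$1$3" "x6 = N$2$3"
  \<comment> \<open>The hypothesis says that the adjugate of \<open>N\<close> vanishes.\<close>
  have minors: "x2 * x3 = x6 * x6" "x1 * x3 = x5 * x5" "x1 * x2 = x4 * x4"
    "x1 * x6 = x4 * x5" "x2 * x5 = x4 * x6" "x3 * x4 = x5 * x6"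
    using adj unfolding mat3_eq_iff
    by (simp_all add: mat_mult_nth trace_mat3 sigma2_def mat_nth N_nth flip: xs) algebra+
  have "\<exists>u1 u2 u3. x1 = u1 * u1 \<and> x2 = u2 * u2 \<and> x3 = u3 * u3 \<and> x4 = u1 * u2 \<and> x5 = u1 * u3
      \<and> x6 = u2 * u3"
  proof -
    consider "x1 \<noteq> 0" | "x1 = 0" "x2 \<noteq> 0" | "x1 = 0" "x2 = 0"
      by blast
    then show ?thesis
    proof cases
      case 1
      define z where "z = csqrt x1"
      have z: "z * z = x1" "z \<noteq> 0"
        using 1 by (auto simp: z_def simp flip: power2_eq_square)
      show ?thesis
        by (rule exI[of _ z], rule exI[of _ "x4 / z"], rule exI[of _ "x5 / z"])
          (use z 1 minors in \<open>simp add: field_simps z\<close>)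
    next
      case 2
      then have "x4 = 0" "x5 = 0"
        using minors by auto
      define z where "z = csqrt x2"
      have z: "z * z = x2" "z \<noteq> 0"
        using 2 by (auto simp: z_def simp flip: power2_eq_square)
      show ?thesis
        by (rule exI[of _ 0], rule exI[of _ z], rule exI[of _ "x6 / z"])
          (use z 2 minors \<open>x4 = 0\<close> \<open>x5 = 0\<close> in \<open>simp add: field_simps z\<close>)
    next
      case 3
      then have "x4 = 0" "x5 = 0" "x6 = 0"
        using minors by auto
      moreover have "csqrt x3 * csqrt x3 = x3"
        by (simp flip: power2_eq_square)
      ultimately show ?thesis
        using 3 by (intro exI[of _ 0] exI[of _ "csqrt x3"]) simp
    qed
  qed
  then obtain u1 u2 u3 where u: "x1 = u1 * u1" "x2 = u2 * u2" "x3 = u3 * u3" "x4 = u1 * u2"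
      "x5 = u1 * u3" "x6 = u2 * u3"
    by blast
  have "\<forall>i j. N $ i $ j = (vector [u1, u2, u3] :: complex^3) $ i * vector [u1, u2, u3] $ j"
    unfolding forall_3 using u by (simp add: N_nth mult.commute flip: xs)
  then show thesis
    using that by blast
qed

text \<open>The only possible eigenvalues are 0 and \<open>c\<close>. Subtracting the one of
  multiplicity at least two leaves a matrix of rank at most one.\<close>

lemma sym_square_smult:
  assumes N: "N \<in> sym_mats" and sq: "N ** N = c *\<^sub>m N"
  obtains d u where "\<And>i j. N $ i $ j = (if i = j then d else 0) + u $ i * u $ (j :: 3)"
proof (cases "N = 0")
  case True
  then show thesis
    by (intro that[of 0 0]) simp
next
  case False
  have "N ** (N ** N) = (c * c) *\<^sub>m N"
    by (simp add: sq mat_distribs)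
  \<comment> \<open>With powers of \<open>N\<close> reduced to multiples of \<open>N\<close>,
    Cayley-Hamilton says that \<open>N\<close> is scalar or that the coefficient on the left
    vanishes.\<close>
  then have ch: "(c * c - trace N * c + sigma2 N) *\<^sub>m N = det N *\<^sub>m mat 1"
    using cayley_hamilton[of N] by (simp add: sq smult_mat_distribs algebra_simps)
  show thesis
  proof (cases "c * c - trace N * c + sigma2 N = 0")
    case False
    define k where "k = det N / (c * c - trace N * c + sigma2 N)"
    have "N = k *\<^sub>m mat 1"
      using arg_cong[OF ch, of "\<lambda>A. (1 / (c * c - trace N * c + sigma2 N)) *\<^sub>m A"] False
      by (simp add: k_def)
    then show thesis
      by (intro that[of k 0]) (simp add: mat_nth)
  next
    case True
    have "trace (N ** N) = trace N * trace N - 2 * sigma2 N"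
      by (simp add: trace_mat3 mat_mult_nth sigma2_def algebra_simps)
    then have t2: "c * trace N = trace N * trace N - 2 * sigma2 N"
      by (simp add: sq trace_smult)
    \<comment> \<open>The ranks one and two of \<open>N\<close> correspond to the traces \<open>c\<close> and \<open>2 c\<close>.\<close>
    have "(trace N - c) * (trace N - 2 * c) = 0"
      using t2 True by algebra
    then consider "trace N = c" | "trace N = 2 * c"
      by auto
    then show thesis
    proof cases
      case 1
      then have "sigma2 N = 0"
        using True by simp
      with 1 have "N ** N - trace N *\<^sub>m N + sigma2 N *\<^sub>m mat 1 = 0"
        by (simp add: sq)
      then obtain u where "\<And>i j. N $ i $ j = u $ i * u $ (j :: 3)"
        using rank_one_sym N by blast
      then show thesis
        by (intro that[of 0 u]) simp
    next
      case 2
      define M where "M = N - c *\<^sub>m mat 1"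
      have "trace M = - c"
        using 2 by (simp add: M_def trace_sub trace_smult trace_I)
      moreover have "sigma2 M = sigma2 N - 2 * c * trace N + 3 * c * c"
        by (simp add: M_def sigma2_def trace_mat3 mat_nth algebra_simps)
      then have "sigma2 M = 0"
        using 2 True by algebra
      moreover have "M ** M = (- c) *\<^sub>m M"
        by (simp add: M_def mat_distribs sq smult_mat_distribs)
      ultimately have "M ** M - trace M *\<^sub>m M + sigma2 M *\<^sub>m mat 1 = 0"
        by simp
      moreover have "M \<in> sym_mats"
        using N by (simp add: M_def sym_mats_iff mat_nth)
      ultimately obtain u where "\<And>i j. M $ i $ j = u $ i * u $ (j :: 3)"
        using rank_one_sym by blast
      then have "N $ i $ j = (if i = j then c else 0) + u $ i * u $ j" for i j
        by (simp add: M_def mat_nth algebra_simps)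
      then show thesis
        by (rule that)
    qed
  qed
qed

text \<open>A special matrix satisfies a quadratic equation. Subtracting a root \<open>k\<close>
  gives \<open>N\<close> whose square is a multiple of \<open>N\<close>.\<close>

lemma special_sym:
  assumes "special a" and sym: "a \<in> sym_mats"
  obtains k u where "\<And>i j. a $ i $ j = (if i = j then k else 0) + u $ i * u $ (j :: 3)"
proof -
  have a: "a \<in> SL3" and "\<not> indep_list [mat 1, a, matrix_inv a]"
    using assms(1) ordinary_iff by (auto simp: special_def)
  then obtain c d e where 0: "c *\<^sub>m mat 1 + d *\<^sub>m a + e *\<^sub>m matrix_inv a = 0"
      "\<not> (c = 0 \<and> d = 0 \<and> e = 0)"
    unfolding indep_list_3 by blast
  have "\<exists>p r. a ** a = p *\<^sub>m a + r *\<^sub>m mat 1"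
  proof (cases "e = 0")
    case True
    then have "d \<noteq> 0"
      using 0 by (auto simp: mat3_eq_iff mat_nth)
    have "d *\<^sub>m a = (- c) *\<^sub>m mat 1"
      using 0(1) True by (simp add: eq_neg_iff_add_eq_0 add.commute)
    then have "a = (- c / d) *\<^sub>m mat 1"
      using \<open>d \<noteq> 0\<close> by (auto simp: mat3_eq_iff mat_nth field_simps)
    then have "a ** a = (- c / d) *\<^sub>m a + 0 *\<^sub>m mat 1"
      by (metis add.right_neutral cmat.scale_zero_left mat_distribs(5) matrix_mul_lid)
    then show ?thesis
      by blast
  next
    case False
    have "e *\<^sub>m matrix_inv a = (- c) *\<^sub>m mat 1 + (- d) *\<^sub>m a"
      using 0(1) by (simp add: eq_neg_iff_add_eq_0 algebra_simps)
    moreover have "matrix_inv a = (1 / e) *\<^sub>m (e *\<^sub>m matrix_inv a)"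
      using False by simp
    ultimately have "matrix_inv a = (1 / e) *\<^sub>m ((- c) *\<^sub>m mat 1 + (- d) *\<^sub>m a)"
      by (simp only:)
    then have "a ** a = (trace a - d / e) *\<^sub>m a + (- sigma2 a - c / e) *\<^sub>m mat 1"
      by (subst SL3_square[OF a]) (simp add: smult_mat_distribs)
    then show ?thesis
      by blast
  qed
  then obtain p r where pr: "a ** a = p *\<^sub>m a + r *\<^sub>m mat 1"
    by blast
  \<comment> \<open>A square root of the discriminant, giving a root \<open>k\<close> of X^2 = p X +
    r.\<close>
  define z where "z = csqrt (p * p + 4 * r)"
  define k where "k = (p + z) / 2"
  have "z * z = p * p + 4 * r"
    by (simp add: z_def flip: power2_eq_square)
  moreover have "2 * k = p + z"
    by (simp add: k_def)
  ultimately have "4 * (k * k - (p * k + r)) = 0"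
    by algebra
  then have k: "k * k = p * k + r"
    unfolding mult_eq_0_iff by simp
  define N where "N = a - k *\<^sub>m mat 1"
  have "N ** N = (p - 2 * k) *\<^sub>m N"
  proof -
    have "N ** N = (p - 2 * k) *\<^sub>m a + (r + k * k) *\<^sub>m mat 1"
      by (simp add: N_def mat_distribs pr smult_mat_distribs mat3_eq_iff mat_nth algebra_simps)
    also have "r + k * k = - ((p - 2 * k) * k)"
      using k by algebra
    also have "(p - 2 * k) *\<^sub>m a + \<dots> *\<^sub>m mat 1 = (p - 2 * k) *\<^sub>m N"
      by (simp add: N_def cmat.scale_right_diff_distrib)
    finally show ?thesis .
  qed
  moreover have "N \<in> sym_mats"
    using sym by (simp add: N_def sym_mats_iff mat_nth)
  ultimately obtain d u where "\<And>i j. N $ i $ j = (if i = j then d else 0) + u $ i * u $ (j :: 3)"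
    using sym_square_smult by blast
  then have "a $ i $ j = (if i = j then d + k else 0) + u $ i * u $ j" for i j
    by (simp add: N_def mat_nth algebra_simps split: if_splits)
  then show thesis
    by (rule that)
qed

section \<open>Outer products and scalar matrices perturbed by rank one\<close>

definition outer :: "complex^3 \<Rightarrow> complex^3 \<Rightarrow> mat3" where
  "outer x y = (\<chi> i j. x $ i * y $ j)"

lemma outer_nth [simp]: "outer x y $ i $ j = x $ i * y $ j"
  by (simp add: outer_def)

lemma mat_mult_vec_nth: "(A *v x) $ i = A$i$1 * x$1 + A$i$2 * x$2 + A$i$3 * x$3" for A :: mat3
  by (simp add: matrix_vector_mult_def sum_3)

lemma mult_outer: "A ** outer x y = outer (A *v x) y"
  by (simp add: mat3_eq_iff mat_mult_nth mat_mult_vec_nth algebra_simps)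

lemma outer_mult_sym:
  assumes "A \<in> sym_mats"
  shows "outer x y ** A = outer x (A *v y)"
  using assms by (simp add: mat3_eq_iff mat_mult_nth mat_mult_vec_nth sym_mats_iff algebra_simps)

lemma outer_distribs:
  "outer (x + y) z = outer x z + outer y z" "outer x (y + z) = outer x y + outer x z"
  "outer (x - y) z = outer x z - outer y z" "outer x (y - z) = outer x y - outer x z"
  "outer (c *s x) y = c *\<^sub>m outer x y" "outer x (c *s y) = c *\<^sub>m outer x y"
  by (simp_all add: mat3_eq_iff algebra_simps)

locale rank_one_pair =
  fixes a b :: mat3 and k :: complex and u :: "complex^3"
  assumes irr: "irreducible_pair a b" and a_SL3: "a \<in> SL3" and b: "b \<in> SL3" "b \<in> sym_mats"
    and a: "a = k *\<^sub>m mat 1 + outer u u"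
begin

abbreviation "bi \<equiv> matrix_inv b"
definition "v = b *v u"
definition "w = bi *v u"

lemma b_mults: "b *v u = v" "bi *v u = w" "b *v w = u" "bi *v v = u"
    "b *v v = trace b *s v - sigma2 b *s u + w"
  by (simp_all add: v_def w_def matrix_vector_mul_assoc SL3_inverse[OF b(1)])
    (simp add: SL3_square[OF b(1)] matrix_vector_mult_add_rdistrib
      matrix_vector_mult_diff_rdistrib smult_mat_mult_vec)

text \<open>The span of \<open>u\<close>, \<open>v\<close>, \<open>w\<close> is invariant under
  \<open>b\<close>, by the expansion of \<open>b *v v\<close>, and under \<open>a\<close>, which
  adds a multiple of \<open>u\<close> to \<open>k *s x\<close>. As \<open>u\<close> is nonzero,
  irreducibility makes it the whole space, and three spanning vectors in dimension three are
  independent.\<close>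

lemma vec_indep:
  assumes 0: "c *s u + d *s v + e *s w = 0"
  shows "c = 0 \<and> d = 0 \<and> e = 0"
proof -
  define V where "V = range (\<lambda>(c, d, e). c *s u + d *s v + e *s w)"
  have VI: "c *s u + d *s v + e *s w \<in> V" for c d e
    unfolding V_def by (rule image_eqI[of _ _ "(c, d, e)"]) auto
  have VE: "\<exists>c d e. x = c *s u + d *s v + e *s w" if "x \<in> V" for x
    using that by (auto simp: V_def)
  have "V = {0} \<or> V = UNIV"
  proof (rule irreducible_pairD[OF irr a_SL3 b(1)])
    show "vec.subspace V"
    proof (rule vec.subspaceI)
      show "0 \<in> V"
        using VI[of 0 0 0] by simp
      show "x + y \<in> V" if xy: "x \<in> V" "y \<in> V" for x y
      proof -
        obtain c d e c' d' e' where "x = c *s u + d *s v + e *s w" "y = c' *s u + d' *s v + e' *s w"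
          using VE xy by meson
        then have "x + y = (c + c') *s u + (d + d') *s v + (e + e') *s w"
          by (simp add: vec.scale_left_distrib)
        then show ?thesis
          by (simp only: VI)
      qed
      show "m *s x \<in> V" if xV: "x \<in> V" for m x
      proof -
        obtain c d e where "x = c *s u + d *s v + e *s w"
          using VE[OF xV] by blast
        then have "m *s x = (m * c) *s u + (m * d) *s v + (m * e) *s w"
          by (simp add: vec.scale_right_distrib)
        then show ?thesis
          by (simp only: VI)
      qed
    qed
    show "b *v x \<in> V" if xV: "x \<in> V" for x
    proof -
      obtain c d e where x: "x = c *s u + d *s v + e *s w"
        using VE[OF xV] by blast
      have "b *v x = (e - d * sigma2 b) *s u + (c + d * trace b) *s v + d *s w"
        by (simp add: x matrix_vector_right_distrib vec.scale b_mults vec.scale_left_distrib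
            vec.scale_right_distrib vec.scale_left_diff_distrib vec.scale_right_diff_distrib)
      then show ?thesis
        by (simp only: VI)
    qed
    show "a *v x \<in> V" if xV: "x \<in> V" for x
    proof -
      obtain c d e where x: "x = c *s u + d *s v + e *s w"
        using VE[OF xV] by blast
      have "a *v x = k *s x + (u$1 * x$1 + u$2 * x$2 + u$3 * x$3) *s u"
        by (simp add: a vec_eq_iff forall_3 mat_mult_vec_nth mat_nth algebra_simps)
      also have "\<dots> = (k * c + (u$1 * x$1 + u$2 * x$2 + u$3 * x$3)) *s u + (k * d) *s v + (k * e) *s w"
        by (simp add: x vec.scale_right_distrib vec.scale_left_distrib)
      finally show ?thesis
        by (simp only: VI)
    qed
  qed
  moreover have "u \<noteq> 0"
  proof
    assume "u = 0"
    then have "a = k *\<^sub>m mat 1"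
      by (simp add: a mat3_eq_iff)
    then show False
      using irreducible_pair_not_commute[OF irr a_SL3 b(1)] by (simp add: mat_distribs)
  qed
  moreover have "u \<in> V"
    using VI[of 1 0 0] by simp
  ultimately have V: "V = UNIV"
    by auto
  \<comment> \<open>The matrix with columns \<open>u\<close>, \<open>v\<close>, \<open>w\<close>;
    surjectivity yields a left inverse.\<close>
  define P :: mat3 where "P = transpose (vector [u, v, w])"
  have P: "P *v x = x$1 *s u + x$2 *s v + x$3 *s w" for x
    by (simp add: P_def vec_eq_iff forall_3 mat_mult_vec_nth transpose_def algebra_simps)
  have "surj ((*v) P)"
    unfolding surj_def
  proof
    fix y
    obtain c d e where "y = c *s u + d *s v + e *s w"
      using VE[of y] V by auto
    then have "y = P *v vector [c, d, e]"
      by (simp add: P)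
    then show "\<exists>x. y = P *v x" ..
  qed
  then obtain R where "R ** P = mat 1"
    by (metis matrix_right_invertible_surjective matrix_left_right_inverse)
  then have "x = 0" if "P *v x = 0" for x
    using that matrix_left_invertible_ker[of P] by blast
  moreover have "P *v vector [c, d, e] = 0"
    using 0 by (simp add: P)
  ultimately have "vector [c, d, e] = (0 :: complex^3)"
    by blast
  then show ?thesis
    by (simp add: vec_eq_iff forall_3)
qed

text \<open>Each column of the relation is a relation between \<open>u\<close>, \<open>v\<close>,
  \<open>w\<close>. Its vanishing coefficients, collected over all columns, form relations between
  the same vectors again.\<close>

lemma wedge_indep:
  assumes 0: "c *\<^sub>m (outer u v - outer v u) + d *\<^sub>m (outer u w - outer w u)
    + e *\<^sub>m (outer v w - outer w v) = 0" (is "?A = 0")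
  shows "c = 0 \<and> d = 0 \<and> e = 0"
proof -
  have *: "(d * w$i + c * v$i) = 0 \<and> (e * w$i - c * u$i) = 0" for i
  proof -
    have "?A $ j $ i = ((d * w$i + c * v$i) *s u + (e * w$i - c * u$i) *s v
        + (- d * u$i - e * v$i) *s w) $ j" for j
      by (simp add: algebra_simps)
    then have "(d * w$i + c * v$i) *s u + (e * w$i - c * u$i) *s v + (- d * u$i - e * v$i) *s w = 0"
      unfolding 0 by (simp add: vec_eq_iff)
    then show ?thesis
      using vec_indep by blast
  qed
  have "0 *s u + c *s v + d *s w = 0" "(- c) *s u + 0 *s v + e *s w = 0"
    using * by (simp_all add: vec_eq_iff algebra_simps)
  then show ?thesis
    using vec_indep by blast
qed

text \<open>Applying the relation to \<open>u\<close> gives a relation between \<open>u\<close>,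
  \<open>v\<close>, \<open>w\<close>. In particular \<open>b\<close> is ordinary.\<close>

lemma indep_b: "indep_list [mat 1, b, bi]"
  unfolding indep_list_3
proof (intro allI impI)
  fix c d e assume 0: "c *\<^sub>m mat 1 + d *\<^sub>m b + e *\<^sub>m bi = 0"
  have "c *s u + d *s v + e *s w = (c *\<^sub>m mat 1 + d *\<^sub>m b + e *\<^sub>m bi) *v u"
    by (simp add: matrix_vector_mult_add_rdistrib smult_mat_mult_vec b_mults)
  then show "c = 0 \<and> d = 0 \<and> e = 0"
    using vec_indep by (simp add: 0)
qed

lemma bi_sym: "bi \<in> sym_mats"
  using b by (rule matrix_inv_sym)

lemma a_sym: "a \<in> sym_mats"
  by (simp add: a sym_mats_iff mat_nth)

lemma mults: "a ** b = k *\<^sub>m b + outer u v" "b ** a = k *\<^sub>m b + outer v u"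
    "a ** bi = k *\<^sub>m bi + outer u w" "bi ** a = k *\<^sub>m bi + outer w u"
    "b ** (a ** bi) = k *\<^sub>m mat 1 + outer v w" "bi ** (a ** b) = k *\<^sub>m mat 1 + outer w v"
  using b bi_sym
  by (simp_all add: a mat_distribs mult_outer outer_mult_sym b_mults SL3_inverse)

lemma sym_basis:
  "is_basis [mat 1, a, b, bi, a ** b + b ** a, a ** bi + bi ** a] sym_mats"
proof (rule is_basis_symI[OF indep_list_6I])
  fix c1 c2 c3 c4 c5 c6
  assume 0: "c1 *\<^sub>m mat 1 + c2 *\<^sub>m a + c3 *\<^sub>m b + c4 *\<^sub>m bi + c5 *\<^sub>m (a ** b + b ** a)
    + c6 *\<^sub>m (a ** bi + bi ** a) = 0"
  define S where "S = c2 *\<^sub>m outer u u + c5 *\<^sub>m (outer u v + outer v u)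
    + c6 *\<^sub>m (outer u w + outer w u)"
  define T where "T = (c1 + k * c2) *\<^sub>m mat 1 + (c3 + 2 * k * c5) *\<^sub>m b + (c4 + 2 * k * c6) *\<^sub>m bi"
  have TS: "T + S = 0"
    using 0 unfolding mults by (simp add: S_def T_def a mat3_eq_iff algebra_simps)
  then have S: "S = - T"
    by (simp add: eq_neg_iff_add_eq_0 add.commute)
  \<comment> \<open>\<open>S\<close> is a polynomial in \<open>b\<close>, hence commutes with \<open>b\<close>.\<close>
  have "b ** S - S ** b = 0"
    by (simp add: S T_def mat_distribs SL3_inverse[OF b(1)])
  \<comment> \<open>The commutator with \<open>b\<close> sends the three symmetric products to wedge
    products, with a triangular coefficient matrix.\<close>
  moreover have "b ** S - S ** b = (- c2 - c5 * trace b) *\<^sub>m (outer u v - outer v u)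
      + (- c5) *\<^sub>m (outer u w - outer w u) + c6 *\<^sub>m (outer v w - outer w v)"
    unfolding S_def mat_distribs mult_outer outer_mult_sym[OF b(2)] b_mults outer_distribs
    by (simp add: mat3_eq_iff algebra_simps)
  ultimately have "- c2 - c5 * trace b = 0 \<and> - c5 = 0 \<and> c6 = 0"
    using wedge_indep by metis
  then have c: "c2 = 0" "c5 = 0" "c6 = 0"
    by auto
  then have "c1 *\<^sub>m mat 1 + c3 *\<^sub>m b + c4 *\<^sub>m bi = 0"
    using TS by (simp add: S_def T_def)
  then have "c1 = 0 \<and> c3 = 0 \<and> c4 = 0"
    using indep_b unfolding indep_list_3 by blast
  with c show "c1 = 0 \<and> c2 = 0 \<and> c3 = 0 \<and> c4 = 0 \<and> c5 = 0 \<and> c6 = 0"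
    by simp
next
  show "set [mat 1, a, b, bi, a ** b + b ** a, a ** bi + bi ** a] \<subseteq> sym_mats"
    unfolding mults using a_sym b bi_sym by (simp add: sym_mats_iff mat_nth algebra_simps)
qed simp

lemma skew_basis:
  "is_basis [a ** b - b ** a, a ** bi - bi ** a, b ** (a ** bi) - bi ** (a ** b)] skew_mats"
proof (rule is_basis_skewI)
  \<comment> \<open>The multiples of \<open>b\<close>, \<open>bi\<close> and \<open>mat 1\<close>
    cancel, leaving wedge products.\<close>
  have eq: "a ** b - b ** a = outer u v - outer v u" "a ** bi - bi ** a = outer u w - outer w u"
    "b ** (a ** bi) - bi ** (a ** b) = outer v w - outer w v"
    unfolding mults(5,6) by (simp_all add: mults(1-4))
  show "indep_list [a ** b - b ** a, a ** bi - bi ** a, b ** (a ** bi) - bi ** (a ** b)]"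
    unfolding eq indep_list_3 using wedge_indep by blast
  show "set [a ** b - b ** a, a ** bi - bi ** a, b ** (a ** bi) - bi ** (a ** b)] \<subseteq> skew_mats"
    unfolding eq by (simp add: skew_mats_iff)
qed simp

end

section \<open>Bases attached to irreducible pairs of symmetric matrices\<close>

theorem theorem3p11:
  fixes a b :: "complex^3^3"
  assumes "a \<in> SL3" and "b \<in> SL3"
    and "a \<in> sym_mats" and "b \<in> sym_mats"
    and "irreducible_pair a b"
  shows
    "(special a \<longrightarrow>
        ordinary b \<and>
        is_basis [mat 1, a, b, matrix_inv b, theta a b [La, Lb], theta a b [La, Lb_inv]] sym_mats \<and>
        is_basis [delta a b [La, Lb], delta a b [La, Lb_inv], delta a b [Lb, La, Lb_inv]] skew_mats)
     \<and>
     (ordinary a \<and> ordinary b \<longrightarrow>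
        ((is_basis [mat 1, a, matrix_inv a, b, matrix_inv b, theta a b [La, Lb]] sym_mats \<and>
          is_basis [delta a b [La, Lb], delta a b [La_inv, Lb], delta a b [La, Lb_inv]] skew_mats \<and>
          is_basis [mat 1, a, matrix_inv a, b, matrix_inv b,
                    a ** b, b ** a, matrix_inv a ** b, a ** matrix_inv b] UNIV)
         \<or>
         (is_basis [mat 1, a, matrix_inv a, b, matrix_inv b, theta a b [La_inv, Lb]] sym_mats \<and>
          is_basis [delta a b [La, Lb], delta a b [La_inv, Lb], delta a b [La_inv, Lb_inv]] skew_mats \<and>
          is_basis [mat 1, a, matrix_inv a, b, matrix_inv b,
                    a ** b, b ** matrix_inv a, matrix_inv a ** b, matrix_inv a ** matrix_inv b] UNIV))
        \<and>
        sym_mats = cmat.span {mat 1, a, matrix_inv a, b, matrix_inv b,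
                              theta a b [La, Lb], theta a b [La_inv, Lb]} \<and>
        skew_mats = cmat.span {delta a b [La, Lb], delta a b [La_inv, Lb],
                               delta a b [La, Lb_inv], delta a b [La_inv, Lb_inv]} \<and>
        UNIV = cmat.span {mat 1, a, matrix_inv a, b, matrix_inv b,
                          a ** b, b ** a, matrix_inv a ** b, b ** matrix_inv a,
                          a ** matrix_inv b, matrix_inv a ** matrix_inv b})"
    (is "(_ \<longrightarrow> ?special) \<and> (_ \<longrightarrow> (?case1 \<or> ?case2) \<and> ?sym \<and> ?skew \<and> ?all)")
proof (intro conjI[of "_ \<longrightarrow> _"] impI)
  assume "special a"
  then obtain k u where "\<And>i j. a $ i $ j = (if i = j then k else 0) + u $ i * u $ (j :: 3)"
    using special_sym assms(3) by blast
  then interpret rank_one_pair a b k u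
    using assms by unfold_locales (auto simp: mat3_eq_iff mat_nth)
  show ?special
    using sym_basis skew_basis indep_b ordinary_iff[OF b(1)]
    by (simp add: theta_def delta_def eval_word_def)
next
  assume "ordinary a \<and> ordinary b"
  then interpret ordinary_sym_pair a b
    using assms irreducible_pair_schur[of a b] by unfold_locales (auto simp: ordinary_iff)
  obtain s t where "s \<in> skew_mats" "t \<in> skew_mats" "s \<noteq> 0 \<or> t \<noteq> 0"
      "a ** s - s ** a = b ** t - t ** b"
    using common_skew_commutator[OF a(2) b(2)] .
  then interpret comm: ordinary_sym_pair_commutators a b s t "a ** s - s ** a"
    by unfold_locales auto
  interpret inv: ordinary_sym_pair_commutators "matrix_inv a" b "- (a ** s ** a)" t "a ** s - s ** a"
    by (rule comm.inverse_commutators)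
  note words = theta_def delta_def eval_word_def
  have cases: "?case1 \<or> ?case2"
    using comm.trace_q_a_b_nonzero
  proof
    assume "trace ((a ** s - s ** a) ** (a ** b)) \<noteq> 0"
    from comm.bases[OF this] have ?case1
      by (simp add: words)
    then show ?thesis ..
  next
    assume nz: "trace ((a ** s - s ** a) ** (matrix_inv a ** b)) \<noteq> 0"
    \<comment> \<open>The bases for the pair of \<open>matrix_inv a\<close> and \<open>b\<close>,
      which agree with those of the second case up to order.\<close>
    note bases = inv.bases[OF nz, unfolded SL3_inverse(4)[OF assms(1)]]
    have ?case2
      by (intro conjI; rule is_basis_perm, rule bases) (simp_all add: words)
    then show ?thesis ..
  qed
  have transpose: "transpose a = a" "transpose b = b" "transpose ai = ai" "transpose bi = bi"
    using a b inv_sym by (auto simp: sym_mats_def)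
  \<comment> \<open>Each asserted spanning set contains the basis found in either case, so the spans
    are the full spaces in both.\<close>
  have sub: "cmat.span X = V" if "is_basis xs V" "set xs \<subseteq> X" "X \<subseteq> V" "cmat.subspace V" for xs X V
    using that cmat.span_mono[of "set xs" X] cmat.span_minimal[of X V]
    by (auto simp: is_basis_def)
  have "{mat 1, a, ai, b, bi, theta a b [La, Lb], theta a b [La_inv, Lb]} \<subseteq> sym_mats"
    by (simp add: words sym_mats_def transpose_distribs matrix_transpose_mul transpose add.commute)
  from sub[symmetric, OF _ _ this subspace_sym_mats] cases have ?sym
    by (elim disjE conjE) auto
  moreover have "{delta a b [La, Lb], delta a b [La_inv, Lb], delta a b [La, Lb_inv],
      delta a b [La_inv, Lb_inv]} \<subseteq> skew_mats"
    by (simp add: words skew_mats_def transpose_distribs matrix_transpose_mul transpose)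
  from sub[symmetric, OF _ _ this subspace_skew_mats] cases have ?skew
    by (elim disjE conjE) auto
  moreover from sub[symmetric, OF _ _ subset_UNIV cmat.subspace_UNIV] cases have ?all
    by (elim disjE conjE) auto
  ultimately show "(?case1 \<or> ?case2) \<and> ?sym \<and> ?skew \<and> ?all"
    using cases by blast
qed

end
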